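(* For every fixed $r>0$, the inverse Fourier representation of $G_1^{(2)}(t,r)$ defines, as a function of $t$, an element of $\mathcal C((0,\infty))\cap L^1_{\mathrm{loc}}([0,\infty))$. Moreover, for every $T>0$ there is a constant $C_T>0$ such that $$|G_1^{(2)}(t,r)|\leqslant C_T\,(1+|\log r|)\qquad\text{for } 0<t\leqslant T,\ 0<r\leqslant 1.$$ Furthermore, $G_1^{(2)}(t,r)\geqslant 0$ for every $t>0$ and $r>0$.
   Context: For $\zeta\in\mathbb R^2$ let $t\mapsto\widehat S_1(t,\zeta)$ be the solution of $y''+|\zeta|^2y'+|\zeta|^2y=0$, $y(0)=0$, $y'(0)=1$; it depends only on $|\zeta|$, and is also written $\widehat S_1(t,\varrho)$ with $\varrho=|\zeta|$. The two-dimensional velocity fundamental solution $G_1^{(2)}(t,x)$ of $v_{tt}-\Delta v-\Delta v_t=0$ is the tempered distribution on $\mathbb R^2$ with Fourier transform $\widehat G_1^{(2)}(t,\zeta)=\widehat S_1(t,\zeta)$ (convention $\widehat f(\zeta)=\int e^{-ix\cdot\zeta}f(x)\,dx$). It is radial and is written $G_1^{(2)}(t,r)$, $r=|x|$; its inverse Fourier (Fourier–Bessel) representation is $$G_1^{(2)}(t,r)=\frac1{2\pi}\int_0^\infty \widehat S_1(t,\varrho)J_0(r\varrho)\,\varrho\,d\varrho,$$ with $J_0$ the Bessel function of the first kind of order zero. *)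

theory Defs
  imports "HOL-Analysis.Analysis"
begin

text \<open>
  The initial value problem \<open>y'' + \<rho>\<^sup>2 y' + \<rho>\<^sup>2 y = 0\<close>, \<open>y(0) = 0\<close>, \<open>y'(0) = 1\<close>, where
  \<open>\<rho> = |\<zeta>|\<close>. Here \<open>y1\<close> and \<open>y2\<close> are the first and second derivatives of \<open>y\<close>. Since the equation
  is linear with constant coefficients, the solution is taken on the whole time axis.
\<close>

definition S1_ivp :: "real \<Rightarrow> (real \<Rightarrow> real) \<Rightarrow> bool" where
  "S1_ivp \<rho> y \<longleftrightarrow>
     (\<exists>y1 y2. (\<forall>t. (y has_real_derivative y1 t) (at t)) \<and>
              (\<forall>t. (y1 has_real_derivative y2 t) (at t)) \<and>
              (\<forall>t. y2 t + \<rho>\<^sup>2 * y1 t + \<rho>\<^sup>2 * y t = 0) \<and>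
              y 0 = 0 \<and> y1 0 = 1)"

lemma S1_ivp_unique_solution: "\<exists>!y. S1_ivp \<rho> y"
proof -
  define a where "a = \<rho>\<^sup>2"
  define d where "d = a\<^sup>2 / 4 - a"
  obtain s c :: "real \<Rightarrow> real" where
    s: "\<And>t. (s has_real_derivative c t) (at t)" and
    c: "\<And>t. (c has_real_derivative d * s t) (at t)" and
    s0: "s 0 = 0" and c0: "c 0 = 1"
  proof -
    consider "d > 0" | "d = 0" | "d < 0" by linarith
    then show thesis
    proof cases
      case 1
      define q where "q = sqrt d"
      have q: "q > 0" "q * q = d" using 1 by (auto simp: q_def)
      show thesis
        by (rule that[of "\<lambda>t. sinh (q * t) / q" "\<lambda>t. cosh (q * t)"])
           (use q in \<open>auto intro!: derivative_eq_intros simp flip: q(2)\<close>)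
    next
      case 2
      show thesis
        by (rule that[of "\<lambda>t. t" "\<lambda>t. 1"]) (use 2 in \<open>auto intro!: derivative_eq_intros\<close>)
    next
      case 3
      define q where "q = sqrt (- d)"
      have q: "q > 0" "d = - (q * q)" using 3 by (auto simp: q_def)
      show thesis
        by (rule that[of "\<lambda>t. sin (q * t) / q" "\<lambda>t. cos (q * t)"])
           (use q in \<open>auto intro!: derivative_eq_intros simp: q(2)\<close>)
    qed
  qed
  have const: "f t = f 0" if "\<And>t. (f has_real_derivative 0) (at t)" for f :: "real \<Rightarrow> real" and t
    using DERIV_isconst_all[of f t 0] that by blast
  have det: "c t * c t - d * s t * s t = 1" for t
  proof -
    have "((\<lambda>t. c t * c t - d * s t * s t) has_real_derivative 0) (at t)" for t
      by (rule DERIV_cong, (rule derivative_intros s c)+) (simp add: algebra_simps)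
    from const[OF this, of t] show ?thesis by (simp add: s0 c0)
  qed
  show ?thesis
  proof (rule ex1I)
    define y where "y = (\<lambda>t. exp (- a / 2 * t) * s t)"
    define y1 where "y1 = (\<lambda>t. exp (- a / 2 * t) * (c t - a / 2 * s t))"
    define y2 where "y2 = (\<lambda>t. exp (- a / 2 * t) * (d * s t - a * c t + a\<^sup>2 / 4 * s t))"
    have "(y has_real_derivative y1 t) (at t)" for t
      unfolding y_def y1_def
      by (auto intro!: derivative_eq_intros s c simp: algebra_simps)
    moreover have "(y1 has_real_derivative y2 t) (at t)" for t
      unfolding y1_def y2_def
      by (rule derivative_eq_intros s c refl | simp)+ (simp add: algebra_simps power2_eq_square add_divide_distrib diff_divide_distrib)
    moreover have "y2 t + a * y1 t + a * y t = 0" for t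
      by (simp add: y_def y1_def y2_def d_def algebra_simps power2_eq_square
        add_divide_distrib diff_divide_distrib)
    ultimately show "S1_ivp \<rho> (\<lambda>t. exp (- a / 2 * t) * s t)"
      unfolding S1_ivp_def a_def[symmetric] y_def[symmetric]
      by (intro exI[of _ y1] exI[of _ y2]) (auto simp: y_def y1_def s0 c0)
  next
    fix y assume "S1_ivp \<rho> y"
    then obtain y1 y2 where y: "\<And>t. (y has_real_derivative y1 t) (at t)"
      "\<And>t. (y1 has_real_derivative y2 t) (at t)"
      "\<And>t. y2 t + a * y1 t + a * y t = 0" "y 0 = 0" "y1 0 = 1"
      unfolding S1_ivp_def a_def[symmetric] by blast
    have y2: "y2 t = - a * y1 t - a * y t" for t
      using y(3)[of t] by simp
    define z where "z = (\<lambda>t. exp (a / 2 * t) * y t)"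
    define w where "w = (\<lambda>t. exp (a / 2 * t) * (y1 t + a / 2 * y t))"
    have z: "(z has_real_derivative w t) (at t)" for t
      unfolding z_def w_def by (auto intro!: derivative_eq_intros y(1,2) simp: algebra_simps)
    have w: "(w has_real_derivative d * z t) (at t)" for t
      unfolding z_def w_def
      by (auto intro!: derivative_eq_intros y(1,2)
        simp: algebra_simps y2 d_def power2_eq_square add_divide_distrib diff_divide_distrib)
    have A: "z t * c t - w t * s t = 0" for t
    proof -
      have "((\<lambda>t. z t * c t - w t * s t) has_real_derivative 0) (at t)" for t
        by (rule DERIV_cong, (rule derivative_intros s c z w)+) (simp add: algebra_simps)
      from const[OF this, of t] show ?thesis by (simp add: s0 z_def y(4))
    qed
    have B: "w t * c t - d * z t * s t = 1" for t
    proof -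
      have "((\<lambda>t. w t * c t - d * z t * s t) has_real_derivative 0) (at t)" for t
        by (rule DERIV_cong, (rule derivative_intros s c z w)+) (simp add: algebra_simps)
      from const[OF this, of t] show ?thesis by (simp add: s0 c0 w_def y(4,5))
    qed
    have "z t = s t" for t
    proof -
      have "z t = z t * (c t * c t - d * s t * s t)" by (simp add: det)
      also have "\<dots> = (z t * c t - w t * s t) * c t + (w t * c t - d * z t * s t) * s t"
        by (simp add: algebra_simps)
      finally show ?thesis by (simp add: A B)
    qed
    then show "y = (\<lambda>t. exp (- a / 2 * t) * s t)"
      unfolding z_def by (auto simp: fun_eq_iff exp_minus field_simps)
  qed
qed

definition S1_hat :: "real \<Rightarrow> real \<Rightarrow> real" where
  "S1_hat t \<rho> = (THE y. S1_ivp \<rho> y) t"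

definition Bessel_J0 :: "real \<Rightarrow> real" where
  "Bessel_J0 x = (\<Sum>k. (-1) ^ k / (fact k)\<^sup>2 * (x / 2) ^ (2 * k))"

text \<open>
  The integrand of the Fourier--Bessel representation decays like \<open>\<rho> powr (-3/2)\<close> when
  \<open>t, r > 0\<close>, so the integral over \<open>(0,\<infinity>)\<close> is read as a Lebesgue integral. The integral operator
  returns \<open>0\<close> on non-integrable functions; integrability therefore has to be asserted separately
  wherever the representation is claimed to define a value.
\<close>

definition G1_integrand :: "real \<Rightarrow> real \<Rightarrow> real \<Rightarrow> real" where
  "G1_integrand t r \<rho> = S1_hat t \<rho> * Bessel_J0 (r * \<rho>) * \<rho>"

definition G1 :: "real \<Rightarrow> real \<Rightarrow> real" where
  "G1 t r = 1 / (2 * pi) * (LINT \<rho>:{0<..}|lborel. G1_integrand t r \<rho>)"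

end

(*
  For t > 0 the Fourier transform has the superposition formula
    S1_hat t rho = exp (-t) * (integral over u in [0,t] of exp ((2 - rho^2) u) J0 (2 sqrt (u (t - u)))),
  obtained by expanding the Laplace transform 1 / (p (p - 2 + 1/p + rho^2)), p = 1 + s, as an
  exponential integral in u. Since exp (- u rho^2) is the transform of the heat kernel, Fubini turns
  the Fourier-Bessel integral into a finite integral of heat kernels over u in [0,t], from which
  continuity, local integrability and the logarithmic bound are read off.

  For the sign, exp t * G1 has Laplace transform K0 (r (sqrt p - 1 / sqrt p)) / (2 pi p), a mixture
  over s of p^(-1) exp (- r cosh s (sqrt p - 1 / sqrt p)). These functions are completely monotone
  because sqrt p - 1 / sqrt p has a completely monotone derivative. Finite differences of the
  Laplace transform therefore alternate in sign, and a Bernstein polynomial approximation in the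
  variable exp (-t) gives nonnegativity of the kernel itself.
*)
theory Submission
  imports Defs "HOL-Probability.Sinc_Integral"
begin

subsection \<open>The Bessel-Clifford function\<close>

text \<open>The Laplace computation only suggests the superposition formula; what is checked is that
  the formula solves the initial value problem, whose solution is unique. The variable p = 1 + s is
  chosen because it turns s^2 + rho^2 s + rho^2 into p times a term in which rho^2 is a pure shift,
  and because the remaining p - 2 + 1/p is the square of sqrt p - 1 / sqrt p; this square root is
  what meets the transform of the heat kernel later.

  The obstacle for the sign is that J0 (2 sqrt (u (t - u))) oscillates, so a superposition of
  positive heat kernels with this weight need not be positive for any visible reason. Only after the
  transform in t does the weight become the positive factor exp (- u / p) / p, and positivity has to
  be carried back from there. Since the kernel is continuous in t, no inversion formula is required:
  it is enough to exclude an interval on which it is negative.\<close>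

definition clifford_coeff :: "nat \<Rightarrow> real" where
  "clifford_coeff k = (-1) ^ k / (fact k)\<^sup>2"

text \<open>For z \<ge> 0 this is J0 (2 sqrt z). As a function of z it is entire, so
  \<open>u * (t - u)\<close> can be inserted and differentiated across its zeros u = 0 and u = t,
  where the square root is not smooth.\<close>

definition clifford :: "real \<Rightarrow> real" where
  "clifford z = (\<Sum>k. clifford_coeff k * z ^ k)"

definition clifford' :: "real \<Rightarrow> real" where
  "clifford' z = (\<Sum>k. diffs clifford_coeff k * z ^ k)"

definition clifford'' :: "real \<Rightarrow> real" where
  "clifford'' z = (\<Sum>k. diffs (diffs clifford_coeff) k * z ^ k)"

lemma abs_clifford_coeff_le: "\<bar>clifford_coeff k\<bar> \<le> 1 / fact k"
proof -
  have "(1::real) \<le> fact k" by simp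
  then have "(fact k :: real) \<le> (fact k)\<^sup>2" by (simp add: power2_eq_square)
  then show ?thesis by (simp add: clifford_coeff_def power_abs frac_le)
qed

lemma summable_clifford: "summable (\<lambda>k. clifford_coeff k * z ^ k)"
proof (rule summable_comparison_test')
  show "summable (\<lambda>k. \<bar>z\<bar> ^ k / fact k)"
    using summable_exp[of "\<bar>z\<bar>"] by (simp add: field_simps)
  show "norm (clifford_coeff k * z ^ k) \<le> \<bar>z\<bar> ^ k / fact k" for k
    using mult_right_mono[OF abs_clifford_coeff_le[of k], of "\<bar>z\<bar> ^ k"]
    by (simp add: abs_mult power_abs)
qed

lemma summable_clifford': "summable (\<lambda>k. diffs clifford_coeff k * z ^ k)"
  by (rule termdiff_converges_all) (rule summable_clifford)

lemma summable_clifford'': "summable (\<lambda>k. diffs (diffs clifford_coeff) k * z ^ k)"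
  by (rule termdiff_converges_all) (rule summable_clifford')

lemma DERIV_clifford: "(clifford has_real_derivative clifford' z) (at z)"
  unfolding clifford_def [abs_def] clifford'_def
  by (rule termdiffs_strong_converges_everywhere) (rule summable_clifford)

lemma DERIV_clifford': "(clifford' has_real_derivative clifford'' z) (at z)"
  unfolding clifford'_def [abs_def] clifford''_def
  by (rule termdiffs_strong_converges_everywhere) (rule summable_clifford')

lemmas [derivative_intros] = DERIV_chain2[OF DERIV_clifford] DERIV_chain2[OF DERIV_clifford']

lemma isCont_clifford'': "isCont clifford'' z"
  unfolding clifford''_def [abs_def]
  by (rule isCont_powser_converges_everywhere) (rule summable_clifford'')

lemma continuous_on_clifford [continuous_intros]:
  "continuous_on S f \<Longrightarrow> continuous_on S (\<lambda>x. clifford (f x))"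
  "continuous_on S f \<Longrightarrow> continuous_on S (\<lambda>x. clifford' (f x))"
  "continuous_on S f \<Longrightarrow> continuous_on S (\<lambda>x. clifford'' (f x))"
  by (auto intro!: continuous_on_compose2[of UNIV clifford] continuous_on_compose2[of UNIV clifford']
      continuous_on_compose2[of UNIV clifford''] continuous_at_imp_continuous_on
      DERIV_isCont DERIV_clifford DERIV_clifford' isCont_clifford'')

lemma borel_measurable_clifford [measurable]: "clifford \<in> borel_measurable borel"
  by (intro borel_measurable_continuous_onI continuous_intros)

text \<open>The coefficients satisfy (k + 1)^2 c_(k+1) = - c_k, which says that the derivative of
  \<open>z * clifford' z\<close> is \<open>- clifford z\<close>. The series with coefficients k c_k
  represents that product and is differentiated termwise.\<close>

lemma clifford_ode: "z * clifford'' z + clifford' z + clifford z = 0"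
proof -
  define a where "a = (\<lambda>k. real k * clifford_coeff k)"
  have shift: "a (Suc k) * z ^ Suc k = z * (diffs clifford_coeff k * z ^ k)" for k and z :: real
    by (simp add: a_def diffs_def)
  have sa: "summable (\<lambda>k. a k * z ^ k)" for z
    using summable_mult[OF summable_clifford', of z z]
    by (subst summable_Suc_iff[symmetric]) (simp only: shift)
  have "(\<Sum>k. a k * z ^ k) = z * clifford' z" for z
    using suminf_split_head[OF sa[of z]] suminf_mult[OF summable_clifford', of z z]
    by (simp only: shift clifford'_def) (simp add: a_def)
  moreover have "((\<lambda>z. \<Sum>k. a k * z ^ k) has_real_derivative (\<Sum>k. diffs a k * z ^ k)) (at z)"
    by (rule termdiffs_strong_converges_everywhere) (rule sa)
  moreover have "diffs a k * z ^ k = - (clifford_coeff k * z ^ k)" for k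
    by (simp add: a_def diffs_def clifford_coeff_def power2_eq_square divide_simps del: of_nat_Suc)
  ultimately have "((\<lambda>z. z * clifford' z) has_real_derivative - clifford z) (at z)"
    by (simp add: suminf_minus[OF summable_clifford] clifford_def)
  moreover have "((\<lambda>z. z * clifford' z) has_real_derivative (clifford' z + z * clifford'' z)) (at z)"
    by (auto intro!: derivative_eq_intros)
  ultimately show ?thesis
    using DERIV_unique by fastforce
qed

lemma clifford_0 [simp]: "clifford 0 = 1"
  unfolding clifford_def by (subst powser_zero) (simp add: clifford_coeff_def)

text \<open>By the differential equation the energy
  \<open>(clifford z)\<^sup>2 + z * (clifford' z)\<^sup>2\<close> has derivative
  \<open>- (clifford' z)\<^sup>2\<close>, and it equals 1 at z = 0.\<close>

lemma abs_clifford_le_1: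
  assumes "0 \<le> z"
  shows "\<bar>clifford z\<bar> \<le> 1"
proof -
  have "(clifford z)\<^sup>2 + z * (clifford' z)\<^sup>2 \<le> (clifford 0)\<^sup>2 + 0 * (clifford' 0)\<^sup>2"
  proof (rule DERIV_nonpos_imp_nonincreasing[OF assms])
    fix x :: real
    have "((\<lambda>z. (clifford z)\<^sup>2 + z * (clifford' z)\<^sup>2) has_real_derivative
        (2 * clifford x * clifford' x + (clifford' x)\<^sup>2 + 2 * clifford' x * (x * clifford'' x))) (at x)"
      by (auto intro!: derivative_eq_intros simp: algebra_simps)
    also have "x * clifford'' x = - clifford' x - clifford x"
      using clifford_ode[of x] by simp
    also have "2 * clifford x * clifford' x + (clifford' x)\<^sup>2
        + 2 * clifford' x * (- clifford' x - clifford x) = - (clifford' x)\<^sup>2"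
      by (simp add: algebra_simps power2_eq_square)
    finally show "\<exists>y. ((\<lambda>z. (clifford z)\<^sup>2 + z * (clifford' z)\<^sup>2) has_real_derivative y) (at x) \<and> y \<le> 0"
      by force
  qed
  moreover have "0 \<le> z * (clifford' z)\<^sup>2" using assms by simp
  ultimately have "(clifford z)\<^sup>2 \<le> 1" by simp
  then show ?thesis by (simp add: abs_square_le_1)
qed

lemma Bessel_J0_eq: "Bessel_J0 x = clifford ((x / 2)\<^sup>2)"
  unfolding Bessel_J0_def clifford_def clifford_coeff_def by (simp add: power_mult)

text \<open>The energy of \<open>w = sqrt x * J\<^sub>0 x\<close>, which solves \<open>w'' + (1 + 1 / (4 x\<^sup>2)) w = 0\<close>, is nonincreasing.\<close>

lemma Bessel_J0_decay: "\<exists>D>0. \<forall>x\<ge>1. \<bar>Bessel_J0 x\<bar> \<le> D / sqrt x"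
proof -
  define j where "j = (\<lambda>x. clifford ((x / 2)\<^sup>2))"
  define j1 where "j1 = (\<lambda>x. clifford' ((x / 2)\<^sup>2) * (x / 2))"
  \<comment> \<open>This is w'^2 + (1 + 1 / (4 x^2)) w^2 written in terms of j and its derivative,
    without square roots. Along solutions only the coefficient contributes to its derivative, namely
    - w^2 / (2 x^3) = - j^2 / (2 x^2).\<close>
  define E where "E = (\<lambda>x. x * ((j1 x)\<^sup>2 + (j x)\<^sup>2) + j x * j1 x + (j x)\<^sup>2 / (2 * x))"
  define j2 where "j2 = (\<lambda>x. clifford'' ((x / 2)\<^sup>2) * (x / 2) * (x / 2) + clifford' ((x / 2)\<^sup>2) / 2)"
  have j: "(j has_real_derivative j1 x) (at x)" for x
    unfolding j_def j1_def
    by (auto intro!: derivative_eq_intros)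
  have j1: "(j1 has_real_derivative j2 x) (at x)" for x
    unfolding j1_def j2_def
    by (auto intro!: derivative_eq_intros)
  have ode: "x * j2 x = - j1 x - x * j x" for x
    using arg_cong[OF clifford_ode[of "(x / 2)\<^sup>2"], of "\<lambda>y. x * y"]
    by (simp add: j_def j1_def j2_def algebra_simps power2_eq_square)
  have "E x \<le> E 1" if "1 \<le> x" for x
  proof (rule DERIV_nonpos_imp_nonincreasing[OF that])
    fix x :: real assume "1 \<le> x"
    then have x: "x > 0" by simp
    have j2: "j2 x = - j1 x / x - j x"
      using ode[of x] x by (simp add: field_simps)
    have "(E has_real_derivative - (j x)\<^sup>2 / (2 * x\<^sup>2)) (at x)"
      unfolding E_def using x
      by (auto intro!: derivative_eq_intros j j1 simp: j2 field_simps power2_eq_square)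
    moreover have "- (j x)\<^sup>2 / (2 * x\<^sup>2) \<le> 0"
      by simp
    ultimately show "\<exists>y. (E has_real_derivative y) (at x) \<and> y \<le> 0" by blast
  qed
  moreover have "x * (j x)\<^sup>2 \<le> E x" if "1 \<le> x" for x
  proof -
    \<comment> \<open>The two terms on the right are w'^2 and w^2 / (4 x^2).\<close>
    have "E x - x * (j x)\<^sup>2 = x * (j1 x + j x / (2 * x))\<^sup>2 + (j x)\<^sup>2 / (4 * x)"
      unfolding E_def using that by (simp add: field_simps power2_eq_square)
    moreover have "0 \<le> x * (j1 x + j x / (2 * x))\<^sup>2 + (j x)\<^sup>2 / (4 * x)"
      using that by simp
    ultimately show ?thesis by linarith
  qed
  ultimately have bd: "x * (j x)\<^sup>2 \<le> \<bar>E 1\<bar> + 1" if "1 \<le> x" for x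
    using that by (meson abs_ge_self add_increasing2 order_trans zero_le_one)
  have "\<bar>j x\<bar> \<le> sqrt (\<bar>E 1\<bar> + 1) / sqrt x" if "1 \<le> x" for x
  proof -
    have "(j x)\<^sup>2 \<le> (\<bar>E 1\<bar> + 1) / x"
      using bd[OF that] that by (simp add: field_simps)
    then have "sqrt ((j x)\<^sup>2) \<le> sqrt ((\<bar>E 1\<bar> + 1) / x)" by (rule real_sqrt_le_mono)
    then show ?thesis by (simp add: real_sqrt_divide)
  qed
  then show ?thesis
    by (intro exI[of _ "sqrt (\<bar>E 1\<bar> + 1)"]) (auto simp: Bessel_J0_eq j_def add_pos_nonneg)
qed

subsection \<open>The superposition formula in time\<close>

text \<open>The integral of g(t, u) over u from 0 to t is pulled back to a fixed interval by u = t
  \<theta>, so the Leibniz rule applies and the sign of t is irrelevant. The boundary term g(t, t)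
  reappears as the integral of the \<theta>-derivative of \<theta> g(t, t \<theta>).\<close>

lemma DERIV_integral_moving_endpoint:
  fixes g gt gu :: "real \<Rightarrow> real \<Rightarrow> real"
  assumes total: "\<And>t \<theta>. ((\<lambda>t. g t (t * \<theta>)) has_real_derivative gt t (t * \<theta>) + \<theta> * gu t (t * \<theta>)) (at t)"
    and gu: "\<And>t u. (g t has_real_derivative gu t u) (at u)"
    and cont: "continuous_on UNIV (\<lambda>(t, u). g t u)" "continuous_on UNIV (\<lambda>(t, u). gt t u)"
      "continuous_on UNIV (\<lambda>(t, u). gu t u)"
  shows "((\<lambda>t. integral {0..1} (\<lambda>\<theta>. t * g t (t * \<theta>))) has_real_derivative
           g t t + integral {0..1} (\<lambda>\<theta>. t * gt t (t * \<theta>))) (at t)"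
proof -
  have [continuous_intros]:
    "continuous_on S a \<Longrightarrow> continuous_on S b \<Longrightarrow> continuous_on S (\<lambda>x. g (a x) (b x))"
    "continuous_on S a \<Longrightarrow> continuous_on S b \<Longrightarrow> continuous_on S (\<lambda>x. gt (a x) (b x))"
    "continuous_on S a \<Longrightarrow> continuous_on S b \<Longrightarrow> continuous_on S (\<lambda>x. gu (a x) (b x))"
    for S :: "'x::topological_space set" and a b
    using cont[THEN continuous_on_compose2, of S "\<lambda>x. (a x, b x)"]
    by (auto intro: continuous_on_Pair)
  define h where "h = (\<lambda>t \<theta>. g t (t * \<theta>) + t * (gt t (t * \<theta>) + \<theta> * gu t (t * \<theta>)))"
  have "((\<lambda>t. integral (cbox 0 1) (\<lambda>\<theta>. t * g t (t * \<theta>))) has_real_derivative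
           integral (cbox 0 1) (h t)) (at t within UNIV)"
  proof (rule leibniz_rule_field_derivative)
    show "((\<lambda>t. t * g t (t * \<theta>)) has_real_derivative h t \<theta>) (at t within UNIV)" for t \<theta>
      unfolding h_def by (auto intro!: derivative_eq_intros total)
    show "(\<lambda>\<theta>. t * g t (t * \<theta>)) integrable_on cbox 0 1" for t
      by (intro integrable_continuous continuous_intros)
    show "continuous_on (UNIV \<times> cbox 0 1) (\<lambda>(t, \<theta>). h t \<theta>)"
      unfolding h_def split_beta by (intro continuous_intros)
  qed auto
  moreover have "(h t has_integral g t t + integral {0..1} (\<lambda>\<theta>. t * gt t (t * \<theta>))) {0..1}"
  proof -
    have "((\<lambda>\<theta>. g t (t * \<theta>) + \<theta> * (t * gu t (t * \<theta>))) has_integral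
        1 * g t (t * 1) - 0 * g t (t * 0)) {0..1}"
    proof (rule fundamental_theorem_of_calculus)
      fix \<theta> :: real
      have "((\<lambda>\<theta>. \<theta> * g t (t * \<theta>)) has_real_derivative
          g t (t * \<theta>) + \<theta> * (t * gu t (t * \<theta>))) (at \<theta>)"
        by (auto intro!: derivative_eq_intros DERIV_chain2[OF gu])
      then show "((\<lambda>\<theta>. \<theta> * g t (t * \<theta>)) has_vector_derivative
          g t (t * \<theta>) + \<theta> * (t * gu t (t * \<theta>))) (at \<theta> within {0..1})"
        by (simp add: has_real_derivative_iff_has_vector_derivative has_vector_derivative_at_within)
    qed simp
    moreover have "((\<lambda>\<theta>. t * gt t (t * \<theta>)) has_integral integral {0..1} (\<lambda>\<theta>. t * gt t (t * \<theta>))) {0..1}"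
      by (intro integrable_integral integrable_continuous_interval continuous_intros)
    ultimately have "((\<lambda>\<theta>. g t (t * \<theta>) + \<theta> * (t * gu t (t * \<theta>)) + t * gt t (t * \<theta>)) has_integral
        1 * g t (t * 1) - 0 * g t (t * 0) + integral {0..1} (\<lambda>\<theta>. t * gt t (t * \<theta>))) {0..1}"
      by (rule has_integral_add)
    then show ?thesis by (simp add: h_def algebra_simps)
  qed
  ultimately show ?thesis by (simp add: integral_unique)
qed

text \<open>For y = exp (-t) Y the equation becomes Y'' - c Y' + Y = 0 with c = 2 - \<rho>^2. Here
  \<open>g1\<close> and \<open>g2\<close> are the first and second t-derivatives of the integrand
  \<open>g0\<close>, while \<open>h0\<close> and \<open>h1\<close> are the u-derivatives of
  \<open>g0\<close> and \<open>g1\<close>.\<close>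

lemma S1_ivp_clifford:
  "S1_ivp \<rho> (\<lambda>t. exp (- t) * integral {0..1} (\<lambda>\<theta>. t * (exp ((2 - \<rho>\<^sup>2) * (t * \<theta>)) * clifford (t * \<theta> * (t - t * \<theta>)))))"
proof -
  define c where "c = 2 - \<rho>\<^sup>2"
  define g0 where "g0 = (\<lambda>t u. exp (c * u) * clifford (u * (t - u)))"
  define g1 where "g1 = (\<lambda>t u. exp (c * u) * u * clifford' (u * (t - u)))"
  define g2 where "g2 = (\<lambda>t u. exp (c * u) * u\<^sup>2 * clifford'' (u * (t - u)))"
  define h0 where "h0 = (\<lambda>t u. exp (c * u) * (c * clifford (u * (t - u)) + (t - 2 * u) * clifford' (u * (t - u))))"
  define h1 where "h1 = (\<lambda>t u. exp (c * u) * (c * u * clifford' (u * (t - u)) + clifford' (u * (t - u))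
    + u * (t - 2 * u) * clifford'' (u * (t - u))))"
  define I where "I = (\<lambda>g::real \<Rightarrow> real \<Rightarrow> real. \<lambda>t. integral {0..1} (\<lambda>\<theta>. t * g t (t * \<theta>)))"
  have Y: "(I g0 has_real_derivative exp (c * t) + I g1 t) (at t)" for t
  proof -
    have "(I g0 has_real_derivative g0 t t + I g1 t) (at t)"
      unfolding I_def
    proof (rule DERIV_integral_moving_endpoint)
      show "((\<lambda>t. g0 t (t * \<theta>)) has_real_derivative g1 t (t * \<theta>) + \<theta> * h0 t (t * \<theta>)) (at t)" for t \<theta>
        unfolding g0_def g1_def h0_def
        by (auto intro!: derivative_eq_intros simp: algebra_simps)
      show "(g0 t has_real_derivative h0 t u) (at u)" for t u
        unfolding g0_def h0_def
        by (auto intro!: derivative_eq_intros simp: algebra_simps)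
    qed (unfold g0_def g1_def h0_def split_beta, (intro continuous_intros)+)
    then show ?thesis by (simp add: g0_def)
  qed
  have Y1: "(I g1 has_real_derivative exp (c * t) * t * clifford' 0 + I g2 t) (at t)" for t
  proof -
    have "(I g1 has_real_derivative g1 t t + I g2 t) (at t)"
      unfolding I_def
    proof (rule DERIV_integral_moving_endpoint)
      show "((\<lambda>t. g1 t (t * \<theta>)) has_real_derivative g2 t (t * \<theta>) + \<theta> * h1 t (t * \<theta>)) (at t)" for t \<theta>
        unfolding g1_def g2_def h1_def
        by (auto intro!: derivative_eq_intros simp: algebra_simps power2_eq_square)
      show "(g1 t has_real_derivative h1 t u) (at u)" for t u
        unfolding g1_def h1_def
        by (auto intro!: derivative_eq_intros simp: algebra_simps power2_eq_square)
    qed (unfold g1_def g2_def h1_def split_beta, (intro continuous_intros)+)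
    then show ?thesis by (simp add: g1_def)
  qed
  \<comment> \<open>By \<open>clifford_ode\<close>, g2 - c g1 + g0 is exactly minus the u-derivative
    of \<open>g1\<close>. The integral therefore collapses to a boundary term, which cancels the one
    produced by the second differentiation in \<open>Y1\<close>.\<close>
  have ode: "I g2 t - c * I g1 t + I g0 t = - (exp (c * t) * t * clifford' 0)" for t
  proof -
    have int: "((\<lambda>\<theta>. t * g t (t * \<theta>)) has_integral I g t) {0..1}" if "g \<in> {g0, g1, g2}" for g
    proof -
      have "continuous_on {0..1} (\<lambda>\<theta>. t * g t (t * \<theta>))"
        using that unfolding g0_def g1_def g2_def
        by (elim insertE emptyE; simp only:; intro continuous_intros)
      then show ?thesis
        unfolding I_def by (intro integrable_integral integrable_continuous_interval)
    qed
    have "((\<lambda>\<theta>. t * g2 t (t * \<theta>) - c * (t * g1 t (t * \<theta>)) + t * g0 t (t * \<theta>)) has_integral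
        I g2 t - c * I g1 t + I g0 t) {0..1}"
      by (intro has_integral_add has_integral_diff has_integral_mult_right int) auto
    moreover have "((\<lambda>\<theta>. t * g2 t (t * \<theta>) - c * (t * g1 t (t * \<theta>)) + t * g0 t (t * \<theta>)) has_integral
        - g1 t (t * 1) - - g1 t (t * 0)) {0..1}"
    proof (rule fundamental_theorem_of_calculus)
      fix \<theta> :: real
      define u where "u = t * \<theta>"
      define z where "z = u * (t - u)"
      have "((\<lambda>\<theta>. - g1 t (t * \<theta>)) has_real_derivative
          - t * (exp (c * u) * (c * u * clifford' z + clifford' z + u * (t - 2 * u) * clifford'' z))) (at \<theta>)"
        unfolding g1_def z_def u_def
        by (auto intro!: derivative_eq_intros simp: algebra_simps power2_eq_square)
      also have "u * (t - 2 * u) * clifford'' z = z * clifford'' z - u\<^sup>2 * clifford'' z"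
        by (simp add: z_def algebra_simps power2_eq_square)
      also have "z * clifford'' z = - clifford' z - clifford z"
        using clifford_ode[of z] by simp
      also have "- t * (exp (c * u) * (c * u * clifford' z + clifford' z + (- clifford' z - clifford z - u\<^sup>2 * clifford'' z)))
          = t * g2 t (t * \<theta>) - c * (t * g1 t (t * \<theta>)) + t * g0 t (t * \<theta>)"
        by (simp add: g0_def g1_def g2_def u_def z_def algebra_simps)
      finally show "((\<lambda>\<theta>. - g1 t (t * \<theta>)) has_vector_derivative
          t * g2 t (t * \<theta>) - c * (t * g1 t (t * \<theta>)) + t * g0 t (t * \<theta>)) (at \<theta> within {0..1})"
        by (simp add: has_real_derivative_iff_has_vector_derivative has_vector_derivative_at_within)
    qed simp
    ultimately have "I g2 t - c * I g1 t + I g0 t = - g1 t (t * 1) - - g1 t (t * 0)"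
      by (rule has_integral_unique)
    then show ?thesis by (simp add: g1_def)
  qed
  define y1 where "y1 = (\<lambda>t. exp (- t) * (exp (c * t) + I g1 t - I g0 t))"
  define y2 where "y2 = (\<lambda>t. exp (- t) * (c * exp (c * t) + exp (c * t) * t * clifford' 0 + I g2 t
    - 2 * (exp (c * t) + I g1 t) + I g0 t))"
  have "((\<lambda>t. exp (- t) * I g0 t) has_real_derivative y1 t) (at t)" for t
    unfolding y1_def by (auto intro!: derivative_eq_intros Y simp: algebra_simps)
  moreover have "(y1 has_real_derivative y2 t) (at t)" for t
    unfolding y1_def y2_def by (auto intro!: derivative_eq_intros Y Y1 simp: algebra_simps)
  moreover have "y2 t + \<rho>\<^sup>2 * y1 t + \<rho>\<^sup>2 * (exp (- t) * I g0 t) = 0" for t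
  proof -
    have "y2 t + \<rho>\<^sup>2 * y1 t + \<rho>\<^sup>2 * (exp (- t) * I g0 t)
        = exp (- t) * (I g2 t - c * I g1 t + I g0 t + exp (c * t) * t * clifford' 0)"
      by (simp add: y1_def y2_def c_def algebra_simps)
    then show ?thesis by (simp add: ode)
  qed
  moreover have "I g 0 = 0" for g by (simp add: I_def)
  ultimately have "S1_ivp \<rho> (\<lambda>t. exp (- t) * I g0 t)"
    unfolding S1_ivp_def by (intro exI[of _ y1] exI[of _ y2]) (auto simp: y1_def)
  then show ?thesis by (simp add: I_def g0_def c_def)
qed

lemma set_lebesgue_integral_rescale:
  fixes f :: "real \<Rightarrow> real"
  assumes "t > 0"
  shows "(LINT u:{0..t}|lborel. f u) = (LINT \<theta>:{0..1}|lborel. t * f (t * \<theta>))"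
proof -
  have "(LINT u:{0..t}|lborel. f u) = \<bar>t\<bar> *\<^sub>R (\<integral>\<theta>. indicator {0..t} (0 + t * \<theta>) *\<^sub>R f (0 + t * \<theta>) \<partial>lborel)"
    unfolding set_lebesgue_integral_def using assms by (subst lborel_integral_real_affine[of t _ 0]) auto
  also have "\<dots> = (\<integral>\<theta>. indicator {0..1} \<theta> *\<^sub>R (t * f (t * \<theta>)) \<partial>lborel)"
    using assms
    by (subst integral_scaleR_right[symmetric], intro Bochner_Integration.integral_cong)
      (auto simp: indicator_def zero_le_mult_iff)
  finally show ?thesis by (simp only: set_lebesgue_integral_def)
qed

lemma S1_hat_eq:
  assumes "t > 0"
  shows "S1_hat t \<rho> = exp (- t) * (LINT u:{0..t}|lborel. exp ((2 - \<rho>\<^sup>2) * u) * clifford (u * (t - u)))"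
proof -
  have "(THE y. S1_ivp \<rho> y) = (\<lambda>t. exp (- t) * integral {0..1} (\<lambda>\<theta>. t * (exp ((2 - \<rho>\<^sup>2) * (t * \<theta>)) * clifford (t * \<theta> * (t - t * \<theta>)))))"
    by (rule the1_equality[of "S1_ivp \<rho>", OF S1_ivp_unique_solution S1_ivp_clifford])
  then have "S1_hat t \<rho> = exp (- t) * integral {0..1} (\<lambda>\<theta>. t * (exp ((2 - \<rho>\<^sup>2) * (t * \<theta>)) * clifford (t * \<theta> * (t - t * \<theta>))))"
    unfolding S1_hat_def by (rule fun_cong)
  also have "integral {0..1} (\<lambda>\<theta>. t * (exp ((2 - \<rho>\<^sup>2) * (t * \<theta>)) * clifford (t * \<theta> * (t - t * \<theta>))))
      = (LINT \<theta>:{0..1}|lborel. t * (exp ((2 - \<rho>\<^sup>2) * (t * \<theta>)) * clifford (t * \<theta> * (t - t * \<theta>))))"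
    by (rule set_borel_integral_eq_integral(2)[OF borel_integrable_atLeastAtMost', symmetric])
      (intro continuous_intros)
  also have "\<dots> = (LINT u:{0..t}|lborel. exp ((2 - \<rho>\<^sup>2) * u) * clifford (u * (t - u)))"
    by (rule set_lebesgue_integral_rescale[OF assms, symmetric])
  finally show ?thesis .
qed

subsection \<open>Laplace and Weber integrals\<close>

text \<open>A moment k! / q^(k+1) cancels one of the two factorials in the coefficients, so termwise
  integration leaves an exponential series. The same moments, taken with absolute values, give the
  summability that justifies the interchange. The Laplace and the Weber integral are both
  instances.\<close>

lemma has_bochner_integral_clifford:
  fixes \<phi> w :: "'a \<Rightarrow> real"
  assumes moments: "\<And>k. has_bochner_integral M (\<lambda>x. \<phi> x * w x ^ k) (c * fact k / q ^ Suc k)"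
    and "\<And>x. 0 \<le> \<phi> x" "\<And>x. 0 \<le> w x" "0 < q"
  shows "has_bochner_integral M (\<lambda>x. \<phi> x * clifford (a * w x)) (c / q * exp (- (a / q)))"
proof -
  define f where "f = (\<lambda>k x. clifford_coeff k * a ^ k * (\<phi> x * w x ^ k))"
  have f_eq: "f k x = \<phi> x * (clifford_coeff k * (a * w x) ^ k)" for k x
    by (simp add: f_def power_mult_distrib)
  have int: "has_bochner_integral M (f k) (clifford_coeff k * a ^ k * (c * fact k / q ^ Suc k))" for k
    unfolding f_def by (intro has_bochner_integral_mult_right moments)
  have norm_f: "norm (f k x) = \<bar>clifford_coeff k * a ^ k\<bar> * (\<phi> x * w x ^ k)" for k x
    using assms by (simp add: f_def abs_mult)
  have int_norm: "(\<integral>x. norm (f k x) \<partial>M) = c / q * (\<bar>a / q\<bar> ^ k / fact k)" for k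
  proof -
    have "(\<integral>x. norm (f k x) \<partial>M) = \<bar>clifford_coeff k * a ^ k\<bar> * (c * fact k / q ^ Suc k)"
      unfolding norm_f by (intro has_bochner_integral_integral_eq has_bochner_integral_mult_right moments)
    also have "\<dots> = c / q * (\<bar>a / q\<bar> ^ k / fact k)"
      using \<open>0 < q\<close> by (simp add: clifford_coeff_def abs_mult power_abs power2_eq_square field_simps)
    finally show ?thesis .
  qed
  have sumf: "(\<Sum>k. f k x) = \<phi> x * clifford (a * w x)" for x
    unfolding f_eq clifford_def by (rule suminf_mult) (rule summable_clifford)
  have "summable (\<lambda>k. norm (f k x))" for x
  proof -
    have "summable (\<lambda>k. norm (clifford_coeff k * (a * w x) ^ k))"
    proof (rule summable_comparison_test')
      show "summable (\<lambda>k. \<bar>a * w x\<bar> ^ k / fact k)"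
        using summable_exp[of "\<bar>a * w x\<bar>"] by (simp add: field_simps)
      show "norm (norm (clifford_coeff k * (a * w x) ^ k)) \<le> \<bar>a * w x\<bar> ^ k / fact k" for k
        using mult_right_mono[OF abs_clifford_coeff_le[of k], of "\<bar>a * w x\<bar> ^ k"]
        by (simp add: abs_mult power_abs)
    qed
    from summable_mult[OF this, of "\<bar>\<phi> x\<bar>"] show ?thesis by (simp add: f_eq abs_mult)
  qed
  moreover have "summable (\<lambda>k. \<integral>x. norm (f k x) \<partial>M)"
    unfolding int_norm using summable_exp[of "\<bar>a / q\<bar>"]
    by (intro summable_mult) (simp add: field_simps)
  moreover have "integrable M (f k)" for k
    using int[of k] by (rule integrable.intros)
  ultimately have "integrable M (\<lambda>x. \<Sum>k. f k x)"
    "(\<integral>x. (\<Sum>k. f k x) \<partial>M) = (\<Sum>k. integral\<^sup>L M (f k))"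
    by (auto intro!: integrable_suminf integral_suminf)
  moreover have "(\<Sum>k. integral\<^sup>L M (f k)) = (\<Sum>k. c / q * ((- (a / q)) ^ k / fact k))"
  proof (rule suminf_cong)
    fix k
    have "integral\<^sup>L M (f k) = clifford_coeff k * a ^ k * (c * fact k / q ^ Suc k)"
      using int by (rule has_bochner_integral_integral_eq)
    also have "\<dots> = c / q * ((- (a / q)) ^ k / fact k)"
      using \<open>0 < q\<close> by (simp add: clifford_coeff_def power_minus[of "a / q"] power2_eq_square field_simps)
    finally show "integral\<^sup>L M (f k) = c / q * ((- (a / q)) ^ k / fact k)" .
  qed
  moreover have "(\<Sum>k. c / q * ((- (a / q)) ^ k / fact k)) = c / q * exp (- (a / q))"
    using sums_mult[OF exp_converges[of "- (a / q)"], of "c / q"]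
    by (intro sums_unique[symmetric]) (simp add: field_simps scaleR_conv_of_real)
  ultimately show ?thesis
    by (simp add: has_bochner_integral_iff sumf)
qed

lemma has_bochner_integral_scale:
  fixes f :: "real \<Rightarrow> real"
  assumes "has_bochner_integral lborel f x" "0 < c"
  shows "has_bochner_integral lborel (\<lambda>y. f (c * y)) (x / c)"
  using lborel_has_bochner_integral_real_affine_iff[of c f x 0] assms by (simp add: field_simps)

lemma has_bochner_integral_Laplace_clifford:
  assumes "0 < q"
  shows "has_bochner_integral lborel (\<lambda>x. indicator {0..} x * exp (- (q * x)) * clifford (a * x))
    (1 / q * exp (- (a / q)))"
proof -
  \<comment> \<open>The absolute value makes the weight nonnegative on the whole line, as the
    general lemma demands; the indicator hides the change.\<close>
  have "has_bochner_integral lborel (\<lambda>x. indicator {0..} x * exp (- (q * x)) * \<bar>x\<bar> ^ k) (1 * fact k / q ^ Suc k)" for k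
  proof -
    have "has_bochner_integral lborel (\<lambda>x::real. indicator {0..} x * (x ^ k * exp (- x))) (fact k)"
    proof (rule has_bochner_integral_nn_integral)
      show "(\<integral>\<^sup>+x. ennreal (indicator {0..} x * (x ^ k * exp (- x))) \<partial>lborel) = ennreal (fact k)"
        unfolding nn_intergal_power_times_exp_Ici[of k, symmetric, simplified]
        by (intro nn_integral_cong) (auto simp: indicator_def)
    qed (auto simp: indicator_def)
    from has_bochner_integral_mult_right[OF has_bochner_integral_scale[OF this assms], of "1 / q ^ k"]
    have "has_bochner_integral lborel
        (\<lambda>x. 1 / q ^ k * (indicator {0..} (q * x) * ((q * x) ^ k * exp (- (q * x)))))
        (1 / q ^ k * (fact k / q))" .
    moreover have "1 / q ^ k * (indicator {0..} (q * x) * ((q * x) ^ k * exp (- (q * x))))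
        = indicator {0..} x * exp (- (q * x)) * \<bar>x\<bar> ^ k" for x
      using assms by (auto simp: indicator_def power_mult_distrib zero_le_mult_iff)
    moreover have "1 / q ^ k * (fact k / q) = 1 * fact k / q ^ Suc k"
      using assms by (simp add: field_simps)
    ultimately show ?thesis by (simp only:)
  qed
  then have "has_bochner_integral lborel (\<lambda>x. indicator {0..} x * exp (- (q * x)) * clifford (a * \<bar>x\<bar>))
    (1 / q * exp (- (a / q)))"
    by (rule has_bochner_integral_clifford) (use assms in auto)
  then show ?thesis
    by (rule has_bochner_integral_cong[THEN iffD1, rotated -1]) (auto simp: indicator_def)
qed

text \<open>Radial form of the fact that the planar Fourier transform of a Gaussian is a Gaussian:
  the value is 2 pi times the heat kernel at time q. The moments are the odd Gaussian moments,
  rescaled by sqrt q.\<close>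

lemma has_bochner_integral_Weber:
  assumes "0 < q"
  shows "has_bochner_integral lborel (\<lambda>x. indicator {0<..} x * (x * exp (- (q * x\<^sup>2)) * Bessel_J0 (r * x)))
    (1 / (2 * q) * exp (- (r\<^sup>2 / (4 * q))))"
proof -
  define s where "s = sqrt q"
  have s: "s > 0" "s\<^sup>2 = q" using assms by (auto simp: s_def)
  have "has_bochner_integral lborel (\<lambda>x. indicator {0..} x * (x * exp (- (q * x\<^sup>2))) * (x\<^sup>2) ^ k) (1 / 2 * fact k / q ^ Suc k)" for k
  proof -
    from has_bochner_integral_mult_right[OF has_bochner_integral_scale[OF gaussian_moment_odd_pos s(1)],
        of "1 / s ^ (2 * k + 1)" k]
    have "has_bochner_integral lborel
        (\<lambda>x. 1 / s ^ (2 * k + 1) * (indicator {0..} (s * x) *\<^sub>R (exp (- (s * x)\<^sup>2) * (s * x) ^ (2 * k + 1))))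
        (1 / s ^ (2 * k + 1) * (fact k / 2 / s))" .
    moreover have "1 / s ^ (2 * k + 1) * (indicator {0..} (s * x) *\<^sub>R (exp (- (s * x)\<^sup>2) * (s * x) ^ (2 * k + 1)))
        = indicator {0..} x * (x * exp (- (q * x\<^sup>2))) * (x\<^sup>2) ^ k" for x
      using s by (auto simp: indicator_def power_mult_distrib zero_le_mult_iff power_mult)
    moreover have "1 / s ^ (2 * k + 1) * (fact k / 2 / s) = 1 / 2 * fact k / q ^ Suc k"
      using s by (simp add: power_mult field_simps power2_eq_square flip: s(2))
    ultimately show ?thesis by (simp only:)
  qed
  then have "has_bochner_integral lborel (\<lambda>x. indicator {0..} x * (x * exp (- (q * x\<^sup>2))) * clifford (r\<^sup>2 / 4 * x\<^sup>2))
    (1 / 2 / q * exp (- (r\<^sup>2 / 4 / q)))"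
    by (rule has_bochner_integral_clifford) (use assms in \<open>auto simp: indicator_def\<close>)
  then show ?thesis
    by (rule has_bochner_integral_cong[THEN iffD1, rotated -1])
      (auto simp: indicator_def Bessel_J0_eq power_mult_distrib power_divide)
qed

subsection \<open>The kernel as a superposition of heat kernels\<close>

text \<open>The heat kernel on the plane at distance \<open>r\<close>, extended by zero to nonpositive times.\<close>

definition heat2 :: "real \<Rightarrow> real \<Rightarrow> real" where
  "heat2 r u = (if u \<le> 0 then 0 else exp (- (r\<^sup>2 / (4 * u))) / (4 * pi * u))"

lemma borel_measurable_heat2 [measurable]: "heat2 r \<in> borel_measurable borel"
  unfolding heat2_def [abs_def] by measurable

lemma heat2_nonneg: "0 \<le> heat2 r u"
  by (simp add: heat2_def)

text \<open>From exp y \<ge> 1 + y with y = r^2 / (4 u). The majorant is rational in u and has a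
  logarithm as primitive, which is the source of the logarithmic bound in r.\<close>

lemma heat2_le:
  assumes "0 < r" "0 \<le> u"
  shows "heat2 r u \<le> 1 / (pi * (4 * u + r\<^sup>2))"
proof (cases "u = 0")
  case False
  with assms have u: "u > 0" by simp
  have "exp (- (r\<^sup>2 / (4 * u))) = 1 / exp (r\<^sup>2 / (4 * u))" by (simp add: exp_minus field_simps)
  also have "\<dots> \<le> 1 / (1 + r\<^sup>2 / (4 * u))"
    using u by (intro divide_left_mono exp_ge_add_one_self) (auto simp: add_pos_nonneg)
  finally have "heat2 r u \<le> 1 / (1 + r\<^sup>2 / (4 * u)) / (4 * pi * u)"
    unfolding heat2_def using u by (subst if_not_P) (auto intro!: divide_right_mono simp del: divide_divide_eq_left)
  also have "\<dots> = 1 / (pi * (4 * u + r\<^sup>2))"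
    using u assms by (simp add: divide_simps add_pos_pos)
  finally show ?thesis .
qed (use assms in \<open>simp add: heat2_def\<close>)

lemma heat2_bounded:
  assumes "0 < r"
  shows "heat2 r u \<le> 1 / (pi * r\<^sup>2)"
proof (cases "0 \<le> u")
  case True
  have "1 / (pi * (4 * u + r\<^sup>2)) \<le> 1 / (pi * r\<^sup>2)"
    using assms True by (intro divide_left_mono mult_left_mono mult_pos_pos) (auto simp: add_nonneg_pos)
  with heat2_le[OF assms True] show ?thesis by simp
qed (simp add: heat2_def)

text \<open>For t, r > 0 this is \<open>exp t * G1 t r\<close>. For t < 0 the interval is empty and
  the value is 0, so Laplace integrals can be taken over the whole line.\<close>

definition wave_kernel :: "real \<Rightarrow> real \<Rightarrow> real" where
  "wave_kernel r t = (LINT u:{0..t}|lborel. exp (2 * u) * clifford (u * (t - u)) * heat2 r u)"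

section \<open>Absolute convergence of the Fourier-Bessel integral\<close>

lemma integrable_powr_neg_three_halves:
  fixes a :: real
  assumes "0 < a"
  shows "set_integrable lborel {a..} (\<lambda>x::real. x powr (- 3 / 2))"
  unfolding set_integrable_def
proof (rule integrableI_nn_integral_finite)
  have "(\<integral>\<^sup>+x. ennreal (x powr (- 3 / 2)) * indicator {a..} x \<partial>lborel)
      = ennreal (0 - - 2 * a powr (- 1 / 2))"
  proof (rule nn_integral_FTC_atLeast)
    show "((\<lambda>x. - 2 * x powr (- 1 / 2)) has_real_derivative x powr (- 3 / 2)) (at x)" if "a \<le> x" for x
      using that assms by (auto intro!: derivative_eq_intros)
    have "((\<lambda>x::real. - 2 * x powr (- 1 / 2)) \<longlongrightarrow> - 2 * 0) at_top"
      by (intro tendsto_mult tendsto_const tendsto_neg_powr filterlim_ident) auto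
    then show "((\<lambda>x. - 2 * x powr (- 1 / 2)) \<longlongrightarrow> (0::real)) at_top" by simp
  qed auto
  then show "(\<integral>\<^sup>+x. ennreal (indicator {a..} x *\<^sub>R x powr (- 3 / 2)) \<partial>lborel)
      = ennreal (2 * a powr (- 1 / 2))"
    by (subst nn_integral_cong[of lborel _ "\<lambda>x. ennreal (x powr (- 3 / 2)) * indicator {a..} x"])
      (auto simp: indicator_def)
qed auto

lemma set_integral_exp_le:
  fixes t \<rho> :: real
  assumes "0 < t"
  shows "(LINT u:{0..t}|lborel. exp (- \<rho>\<^sup>2 * u)) \<le> t"
    and "0 < \<rho> \<Longrightarrow> (LINT u:{0..t}|lborel. exp (- \<rho>\<^sup>2 * u)) \<le> 1 / \<rho>\<^sup>2"
proof -
  have int: "set_integrable lborel {0..t} (\<lambda>u. exp (- \<rho>\<^sup>2 * u))"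
    by (intro borel_integrable_atLeastAtMost' continuous_intros)
  have "(LINT u:{0..t}|lborel. exp (- \<rho>\<^sup>2 * u)) \<le> (LINT u:{0..t}|lborel. 1)"
    using int by (intro set_integral_mono borel_integrable_atLeastAtMost' continuous_intros) auto
  also have "\<dots> = t" using assms by (simp add: set_lebesgue_integral_def)
  finally show "(LINT u:{0..t}|lborel. exp (- \<rho>\<^sup>2 * u)) \<le> t" .
  assume \<rho>: "0 < \<rho>"
  have "((\<lambda>u. exp (- \<rho>\<^sup>2 * u)) has_integral - exp (- \<rho>\<^sup>2 * t) / \<rho>\<^sup>2 - - exp (- \<rho>\<^sup>2 * 0) / \<rho>\<^sup>2) {0..t}"
    using assms \<rho>
    by (intro fundamental_theorem_of_calculus)
      (auto intro!: derivative_eq_intros simp: divide_simps simp flip: has_real_derivative_iff_has_vector_derivative)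
  then have "(LINT u:{0..t}|lborel. exp (- \<rho>\<^sup>2 * u)) = (1 - exp (- \<rho>\<^sup>2 * t)) / \<rho>\<^sup>2"
    using set_borel_integral_eq_integral(2)[OF int] by (simp add: integral_unique diff_divide_distrib)
  also have "\<dots> \<le> 1 / \<rho>\<^sup>2" by (intro divide_right_mono) auto
  finally show "(LINT u:{0..t}|lborel. exp (- \<rho>\<^sup>2 * u)) \<le> 1 / \<rho>\<^sup>2" .
qed

lemma borel_measurable_Bessel_J0 [measurable]: "Bessel_J0 \<in> borel_measurable borel"
  unfolding Bessel_J0_eq [abs_def] by measurable

lemma abs_Bessel_J0_le_1: "\<bar>Bessel_J0 x\<bar> \<le> 1"
  unfolding Bessel_J0_eq by (rule abs_clifford_le_1) simp

text \<open>At infinity the integral over u gains \<rho>^(-2), which with |J0| \<le> 1 alone would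
  leave 1 / \<rho> and a logarithmic divergence. The decay of J0 improves this to \<rho>^(-3/2). It
  is available for r \<rho> \<ge> 1, so the majorant changes at \<rho> = 1 / r; below that point the
  bounds 1 for |J0|, 1 / r for \<rho> and t for the inner integral suffice.\<close>

lemma integrable_Bessel_bound:
  assumes "0 < t" "0 < r"
  shows "set_integrable lborel {0<..} (\<lambda>\<rho>. \<bar>Bessel_J0 (r * \<rho>)\<bar> * \<rho> * (LINT u:{0..t}|lborel. exp (- \<rho>\<^sup>2 * u)))"
proof -
  obtain D where D: "D > 0" "\<And>x. x \<ge> 1 \<Longrightarrow> \<bar>Bessel_J0 x\<bar> \<le> D / sqrt x"
    using Bessel_J0_decay by blast
  let ?I = "\<lambda>\<rho>. (LINT u:{0..t}|lborel. exp (- \<rho>\<^sup>2 * u))"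
  let ?b = "\<lambda>\<rho>. indicator {0..1 / r} \<rho> *\<^sub>R (t / r) + D / sqrt r * (indicator {1 / r..} \<rho> *\<^sub>R \<rho> powr (- 3 / 2))"
  have I0: "0 \<le> ?I \<rho>" for \<rho> by (simp add: set_lebesgue_integral_def)
  show ?thesis
    unfolding set_integrable_def
  proof (rule Bochner_Integration.integrable_bound)
    have "set_integrable lborel {0..1 / r} (\<lambda>_. t / r)"
      by (intro borel_integrable_atLeastAtMost' continuous_intros)
    moreover have "set_integrable lborel {1 / r..} (\<lambda>x. x powr (- 3 / 2))"
      using assms by (intro integrable_powr_neg_three_halves) auto
    ultimately show "integrable lborel ?b"
      unfolding set_integrable_def by (intro Bochner_Integration.integrable_add integrable_mult_right)
    show "(\<lambda>\<rho>. indicat_real {0<..} \<rho> *\<^sub>R (\<bar>Bessel_J0 (r * \<rho>)\<bar> * \<rho> * ?I \<rho>)) \<in> borel_measurable lborel"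
      unfolding set_lebesgue_integral_def by measurable
    have le: "norm (indicat_real {0<..} \<rho> *\<^sub>R (\<bar>Bessel_J0 (r * \<rho>)\<bar> * \<rho> * ?I \<rho>)) \<le> ?b \<rho>" for \<rho>
    proof (cases "0 < \<rho>")
      case \<rho>: True
      show ?thesis
      proof (cases "\<rho> < 1 / r")
        case True
        have "\<bar>Bessel_J0 (r * \<rho>)\<bar> * \<rho> * ?I \<rho> \<le> 1 * (1 / r) * t"
          using \<rho> True set_integral_exp_le(1)[OF assms(1), of \<rho>] abs_Bessel_J0_le_1 I0 assms
          by (intro mult_mono) auto
        then show ?thesis using \<rho> True I0[of \<rho>] by (simp add: abs_mult field_simps)
      next
        case False
        then have "1 \<le> r * \<rho>" using assms by (simp add: field_simps)
        then have "\<bar>Bessel_J0 (r * \<rho>)\<bar> * \<rho> * ?I \<rho> \<le> D / sqrt (r * \<rho>) * \<rho> * (1 / \<rho>\<^sup>2)"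
          using \<rho> False set_integral_exp_le(2)[OF assms(1) \<rho>] D I0 assms
          by (intro mult_mono) auto
        also have "\<dots> = D / sqrt r * \<rho> powr (- 3 / 2)"
        proof -
          have "\<rho> powr (- 3 / 2) = \<rho> powr (- 1) * \<rho> powr (- 1 / 2)" by (subst powr_add[symmetric]) simp
          also have "\<dots> = 1 / \<rho> * (1 / sqrt \<rho>)"
            using \<rho> by (simp add: powr_minus powr_half_sqrt[symmetric] field_simps)
          finally have "\<rho> powr (- 3 / 2) = 1 / \<rho> * (1 / sqrt \<rho>)" .
          then show ?thesis using \<rho> by (simp only:) (simp add: real_sqrt_mult power2_eq_square)
        qed
        also have "\<dots> \<le> ?b \<rho>" using False \<rho> assms by (auto simp: indicator_def)
        finally show ?thesis using \<rho> I0[of \<rho>] by (simp add: abs_mult)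
      qed
    next
      case False
      have "0 \<le> ?b \<rho>" using assms D by (auto simp: indicator_def)
      with False show ?thesis by simp
    qed
    show "AE \<rho> in lborel. norm (indicat_real {0<..} \<rho> *\<^sub>R (\<bar>Bessel_J0 (r * \<rho>)\<bar> * \<rho> * ?I \<rho>)) \<le> norm (?b \<rho>)"
      unfolding real_norm_def by (intro AE_I2 order_trans[OF le[unfolded real_norm_def] abs_ge_self])
  qed
qed

lemma G1_eq_wave_kernel:
  assumes "0 < t" "0 < r"
  shows "set_integrable lborel {0<..} (G1_integrand t r)"
    and "G1 t r = exp (- t) * wave_kernel r t"
proof -
  define F where "F = (\<lambda>(\<rho>, u). indicator {0<..} \<rho> * indicator {0..t} u *
    (Bessel_J0 (r * \<rho>) * \<rho> * (exp ((2 - \<rho>\<^sup>2) * u) * clifford (u * (t - u)))))"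
  have F_inner: "(\<integral>u. F (\<rho>, u) \<partial>lborel) = exp t * (indicator {0<..} \<rho> *\<^sub>R G1_integrand t r \<rho>)" for \<rho>
  proof -
    have "(\<integral>u. F (\<rho>, u) \<partial>lborel) = (\<integral>u. indicator {0<..} \<rho> * (Bessel_J0 (r * \<rho>) * \<rho>) *
        (indicator {0..t} u *\<^sub>R (exp ((2 - \<rho>\<^sup>2) * u) * clifford (u * (t - u)))) \<partial>lborel)"
      by (intro Bochner_Integration.integral_cong) (auto simp: F_def)
    also have "\<dots> = exp t * (indicator {0<..} \<rho> *\<^sub>R G1_integrand t r \<rho>)"
      by (subst integral_mult_right_zero)
        (simp add: G1_integrand_def S1_hat_eq[OF assms(1)] set_lebesgue_integral_def exp_minus)
    finally show ?thesis .
  qed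
  have F_le: "norm (F (\<rho>, u)) \<le> exp (2 * t) * (indicator {0<..} \<rho> * (\<bar>Bessel_J0 (r * \<rho>)\<bar> * \<rho>)) *
      (indicator {0..t} u * exp (- \<rho>\<^sup>2 * u))" for \<rho> u
  proof (cases "0 < \<rho> \<and> u \<in> {0..t}")
    case True
    have "exp ((2 - \<rho>\<^sup>2) * u) * \<bar>clifford (u * (t - u))\<bar> \<le> exp (2 * t) * exp (- \<rho>\<^sup>2 * u) * 1"
    proof (rule mult_mono)
      have "(2 - \<rho>\<^sup>2) * u \<le> 2 * t + - \<rho>\<^sup>2 * u" using True by (simp add: algebra_simps)
      then show "exp ((2 - \<rho>\<^sup>2) * u) \<le> exp (2 * t) * exp (- \<rho>\<^sup>2 * u)" by (simp flip: exp_add)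
    qed (use True in \<open>auto intro!: abs_clifford_le_1\<close>)
    from mult_left_mono[OF this, of "\<bar>Bessel_J0 (r * \<rho>)\<bar> * \<rho>"] True show ?thesis
      by (simp add: F_def abs_mult algebra_simps)
  qed (auto simp: F_def indicator_def)
  have [measurable]: "F \<in> borel_measurable (lborel \<Otimes>\<^sub>M lborel)"
    unfolding F_def by measurable
  have int_u: "integrable lborel (\<lambda>u. indicator {0..t} u * exp (- \<rho>\<^sup>2 * u))" for \<rho>
  proof -
    have "continuous_on {0..t} (\<lambda>u. exp (- \<rho>\<^sup>2 * u))" by (intro continuous_intros)
    from borel_integrable_atLeastAtMost'[OF this] show ?thesis by (simp add: set_integrable_def)
  qed
  have int_F: "integrable lborel (\<lambda>u. F (\<rho>, u))" for \<rho>
  proof (rule Bochner_Integration.integrable_bound)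
    show "integrable lborel (\<lambda>u. exp (2 * t) * (indicator {0<..} \<rho> * (\<bar>Bessel_J0 (r * \<rho>)\<bar> * \<rho>)) *
        (indicator {0..t} u * exp (- \<rho>\<^sup>2 * u)))"
      by (rule integrable_mult_right[OF int_u])
    show "AE u in lborel. norm (F (\<rho>, u)) \<le> norm (exp (2 * t) * (indicator {0<..} \<rho> * (\<bar>Bessel_J0 (r * \<rho>)\<bar> * \<rho>)) *
        (indicator {0..t} u * exp (- \<rho>\<^sup>2 * u)))"
      unfolding real_norm_def by (intro AE_I2 order_trans[OF F_le[unfolded real_norm_def] abs_ge_self])
  qed measurable
  have F: "integrable (lborel \<Otimes>\<^sub>M lborel) F"
  \<comment> \<open>The variable u is integrated first: the norm without the Bessel decay,
    integrated over \<rho> first, would behave like 1 / u near u = 0.\<close>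
  proof (rule lborel_pair.Fubini_integrable)
    show "AE \<rho> in lborel. integrable lborel (\<lambda>u. F (\<rho>, u))"
      using int_F by simp
    show "integrable lborel (\<lambda>\<rho>. \<integral>u. norm (F (\<rho>, u)) \<partial>lborel)"
    proof (rule Bochner_Integration.integrable_bound)
      show "integrable lborel (\<lambda>\<rho>. exp (2 * t) * (indicator {0<..} \<rho> *\<^sub>R (\<bar>Bessel_J0 (r * \<rho>)\<bar> * \<rho> * (LINT u:{0..t}|lborel. exp (- \<rho>\<^sup>2 * u)))))"
        using integrable_Bessel_bound[OF assms] unfolding set_integrable_def by (rule integrable_mult_right)
      have norm_mono: "0 \<le> a \<Longrightarrow> a \<le> b \<Longrightarrow> norm a \<le> norm b" for a b :: real by simp
      have le: "(\<integral>u. norm (F (\<rho>, u)) \<partial>lborel) \<le>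
        exp (2 * t) * (indicator {0<..} \<rho> *\<^sub>R (\<bar>Bessel_J0 (r * \<rho>)\<bar> * \<rho> * (LINT u:{0..t}|lborel. exp (- \<rho>\<^sup>2 * u))))" for \<rho>
      proof -
        have "(\<integral>u. norm (F (\<rho>, u)) \<partial>lborel) \<le> (\<integral>u. exp (2 * t) * (indicator {0<..} \<rho> * (\<bar>Bessel_J0 (r * \<rho>)\<bar> * \<rho>)) *
          (indicator {0..t} u * exp (- \<rho>\<^sup>2 * u)) \<partial>lborel)"
          by (intro integral_mono integrable_norm integrable_mult_right int_F int_u F_le)
        then show ?thesis by (simp add: set_lebesgue_integral_def mult.assoc)
      qed
      show "AE \<rho> in lborel. norm (\<integral>u. norm (F (\<rho>, u)) \<partial>lborel) \<le>
        norm (exp (2 * t) * (indicator {0<..} \<rho> *\<^sub>R (\<bar>Bessel_J0 (r * \<rho>)\<bar> * \<rho> * (LINT u:{0..t}|lborel. exp (- \<rho>\<^sup>2 * u)))))"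
        by (intro AE_I2 norm_mono le) simp
    qed measurable
  qed measurable
  have "integrable lborel (\<lambda>\<rho>. exp (- t) * (exp t * (indicator {0<..} \<rho> *\<^sub>R G1_integrand t r \<rho>)))"
    using lborel_pair.integrable_fst'[OF F] unfolding F_inner by (rule integrable_mult_right)
  then show "set_integrable lborel {0<..} (G1_integrand t r)"
    by (simp add: set_integrable_def exp_minus)
  have "exp t * (LINT \<rho>:{0<..}|lborel. G1_integrand t r \<rho>) = (\<integral>\<rho>. (\<integral>u. F (\<rho>, u) \<partial>lborel) \<partial>lborel)"
    unfolding F_inner set_lebesgue_integral_def by simp
  also have "\<dots> = (\<integral>u. (\<integral>\<rho>. F (\<rho>, u) \<partial>lborel) \<partial>lborel)"
    using lborel_pair.Fubini_integral[of "\<lambda>\<rho> u. F (\<rho>, u)"] F by simp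
  also have "\<dots> = (\<integral>u. 2 * pi * (indicator {0..t} u *\<^sub>R (exp (2 * u) * clifford (u * (t - u)) * heat2 r u)) \<partial>lborel)"
  proof (rule integral_cong_AE)
    \<comment> \<open>The Weber integral needs u > 0, so the null set u = 0 is discarded.\<close>
    have inner: "(\<integral>\<rho>. F (\<rho>, u) \<partial>lborel) = 2 * pi * (indicator {0..t} u *\<^sub>R (exp (2 * u) * clifford (u * (t - u)) * heat2 r u))"
      if "u \<noteq> 0" for u
    proof (cases "u \<in> {0..t}")
      case True
      with that have u: "0 < u" by simp
      have "(\<integral>\<rho>. F (\<rho>, u) \<partial>lborel) = (\<integral>\<rho>. exp (2 * u) * clifford (u * (t - u)) *
          (indicator {0<..} \<rho> * (\<rho> * exp (- (u * \<rho>\<^sup>2)) * Bessel_J0 (r * \<rho>))) \<partial>lborel)"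
        using True by (intro Bochner_Integration.integral_cong)
          (auto simp: F_def algebra_simps simp flip: exp_add)
      also have "\<dots> = exp (2 * u) * clifford (u * (t - u)) * (1 / (2 * u) * exp (- (r\<^sup>2 / (4 * u))))"
        by (intro has_bochner_integral_integral_eq has_bochner_integral_mult_right has_bochner_integral_Weber u)
      also have "\<dots> = 2 * pi * (indicator {0..t} u *\<^sub>R (exp (2 * u) * clifford (u * (t - u)) * heat2 r u))"
        using True u by (simp add: heat2_def)
      finally show ?thesis .
    qed (simp add: F_def)
    show "AE u in lborel. (\<integral>\<rho>. F (\<rho>, u) \<partial>lborel) =
        2 * pi * (indicator {0..t} u *\<^sub>R (exp (2 * u) * clifford (u * (t - u)) * heat2 r u))"
      using AE_lborel_singleton[of 0] by eventually_elim (rule inner)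
  qed measurable
  also have "\<dots> = 2 * pi * wave_kernel r t"
    by (simp add: wave_kernel_def set_lebesgue_integral_def)
  finally show "G1 t r = exp (- t) * wave_kernel r t"
    by (simp add: G1_def exp_minus field_simps)
qed

subsection \<open>Regularity and bounds\<close>

lemma abs_wave_kernel_integrand_le:
  assumes "0 < r" "u \<in> {0..t}"
  shows "\<bar>exp (2 * u) * clifford (u * (t - u)) * heat2 r u\<bar> \<le> exp (2 * t) * (1 / (pi * (4 * u + r\<^sup>2)))"
proof -
  have "\<bar>exp (2 * u) * clifford (u * (t - u)) * heat2 r u\<bar>
      = exp (2 * u) * \<bar>clifford (u * (t - u))\<bar> * heat2 r u"
    by (simp add: abs_mult heat2_nonneg)
  also have "\<dots> \<le> exp (2 * t) * 1 * (1 / (pi * (4 * u + r\<^sup>2)))"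
    using assms by (intro mult_mono heat2_le abs_clifford_le_1 heat2_nonneg) auto
  finally show ?thesis by simp
qed

lemma abs_wave_kernel_le:
  assumes "0 < r" "0 < t"
  shows "\<bar>wave_kernel r t\<bar> \<le> exp (2 * t) * ((ln (4 * t + r\<^sup>2) - 2 * ln r) / (4 * pi))"
proof -
  have pos: "0 < 4 * u + r\<^sup>2" if "0 \<le> u" for u :: real
    using that assms by (simp add: add_nonneg_pos)
  have "continuous_on {0..t} (\<lambda>u. exp (2 * t) * (1 / (pi * (4 * u + r\<^sup>2))))"
    using pos by (intro continuous_intros) force
  then have int: "set_integrable lborel {0..t} (\<lambda>u. exp (2 * t) * (1 / (pi * (4 * u + r\<^sup>2))))"
    by (rule borel_integrable_atLeastAtMost')
  have "\<bar>wave_kernel r t\<bar> \<le> (\<integral>u. norm (indicator {0..t} u *\<^sub>R (exp (2 * u) * clifford (u * (t - u)) * heat2 r u)) \<partial>lborel)"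
    unfolding wave_kernel_def set_lebesgue_integral_def real_norm_def[symmetric] by (rule integral_norm_bound)
  also have "\<dots> \<le> (LINT u:{0..t}|lborel. exp (2 * t) * (1 / (pi * (4 * u + r\<^sup>2))))"
    unfolding set_lebesgue_integral_def
  proof (rule integral_mono')
    show "integrable lborel (\<lambda>u. indicat_real {0..t} u *\<^sub>R (exp (2 * t) * (1 / (pi * (4 * u + r\<^sup>2)))))"
      using int by (simp add: set_integrable_def)
    show "norm (indicator {0..t} u *\<^sub>R (exp (2 * u) * clifford (u * (t - u)) * heat2 r u))
        \<le> indicat_real {0..t} u *\<^sub>R (exp (2 * t) * (1 / (pi * (4 * u + r\<^sup>2))))" for u
      using abs_wave_kernel_integrand_le[OF assms(1), of u t] by (cases "u \<in> {0..t}") auto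
    show "0 \<le> indicat_real {0..t} u *\<^sub>R (exp (2 * t) * (1 / (pi * (4 * u + r\<^sup>2))))" for u
      using pos[of u] by (auto simp: indicator_def)
  qed
  also have "\<dots> = exp (2 * t) * ((ln (4 * t + r\<^sup>2) - 2 * ln r) / (4 * pi))"
  proof -
    have "((\<lambda>u. exp (2 * t) * (1 / (pi * (4 * u + r\<^sup>2)))) has_integral
        exp (2 * t) * (ln (4 * t + r\<^sup>2) / (4 * pi)) - exp (2 * t) * (ln (4 * 0 + r\<^sup>2) / (4 * pi))) {0..t}"
    proof (rule fundamental_theorem_of_calculus)
      fix u assume "u \<in> {0..t}"
      then have "0 < 4 * u + r\<^sup>2" using pos by simp
      then have "((\<lambda>u. exp (2 * t) * (ln (4 * u + r\<^sup>2) / (4 * pi))) has_real_derivative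
          exp (2 * t) * (1 / (pi * (4 * u + r\<^sup>2)))) (at u)"
        by (auto intro!: derivative_eq_intros simp: divide_simps)
      then show "((\<lambda>u. exp (2 * t) * (ln (4 * u + r\<^sup>2) / (4 * pi))) has_vector_derivative
          exp (2 * t) * (1 / (pi * (4 * u + r\<^sup>2)))) (at u within {0..t})"
        by (simp add: has_real_derivative_iff_has_vector_derivative has_vector_derivative_at_within)
    qed (use assms in simp)
    then show ?thesis
      using set_borel_integral_eq_integral(2)[OF int] assms
      by (simp add: integral_unique ln_realpow diff_divide_distrib right_diff_distrib)
  qed
  finally show ?thesis .
qed

lemma abs_G1_le:
  assumes "0 < r" "0 < t" "t \<le> T"
  shows "\<bar>G1 t r\<bar> \<le> exp T * ((ln (4 * T + r\<^sup>2) - 2 * ln r) / (4 * pi))"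
proof -
  have "\<bar>G1 t r\<bar> = exp (- t) * \<bar>wave_kernel r t\<bar>"
    using assms by (simp add: G1_eq_wave_kernel abs_mult)
  also have "\<dots> \<le> exp (- t) * (exp (2 * t) * ((ln (4 * t + r\<^sup>2) - 2 * ln r) / (4 * pi)))"
    using assms by (intro mult_left_mono abs_wave_kernel_le) auto
  also have "\<dots> = exp t * ((ln (4 * t + r\<^sup>2) - 2 * ln r) / (4 * pi))"
    by (simp flip: exp_add mult.assoc)
  also have "\<dots> \<le> exp T * ((ln (4 * T + r\<^sup>2) - 2 * ln r) / (4 * pi))"
  proof (intro mult_mono divide_right_mono diff_right_mono)
    show "ln (4 * t + r\<^sup>2) \<le> ln (4 * T + r\<^sup>2)"
      using assms by (intro ln_mono) (auto simp: add_pos_pos)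
    \<comment> \<open>The difference of logarithms must be nonnegative before its factor exp t may
      be enlarged to exp T.\<close>
    have "ln (r\<^sup>2) \<le> ln (4 * t + r\<^sup>2)"
      using assms by (intro ln_mono) (auto simp: add_pos_pos)
    then show "0 \<le> (ln (4 * t + r\<^sup>2) - 2 * ln r) / (4 * pi)"
      using assms by (simp add: ln_realpow)
  qed (use assms in auto)
  finally show ?thesis .
qed

text \<open>After rescaling to \<open>{0..1}\<close> the domain no longer moves with t. For fixed r
  > 0 the heat kernel is bounded uniformly in time, so a constant dominates along any convergent
  sequence of times.\<close>

lemma continuous_on_wave_kernel:
  assumes "0 < r"
  shows "continuous_on {0<..} (wave_kernel r)"
  unfolding continuous_on_sequentially
proof safe
  fix a :: real and x :: "nat \<Rightarrow> real"
  assume a: "a > 0" and x: "\<forall>n. x n \<in> {0<..}" "x \<longlonglongrightarrow> a"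
  define h where "h = (\<lambda>t \<theta>. t * (exp (2 * (t * \<theta>)) * clifford (t * \<theta> * (t - t * \<theta>)) * heat2 r (t * \<theta>)))"
  have eq: "wave_kernel r t = (\<integral>\<theta>. indicator {0..1} \<theta> * h t \<theta> \<partial>lborel)" if "t > 0" for t
    unfolding wave_kernel_def set_lebesgue_integral_rescale[OF that]
    by (simp only: h_def set_lebesgue_integral_def real_scaleR_def)
  obtain M where M: "\<And>n. \<bar>x n\<bar> \<le> M"
    using x(2) by (metis Bseq_def convergentI convergent_imp_Bseq real_norm_def)
  have le: "\<bar>h t \<theta>\<bar> \<le> M * (exp (2 * M) * (1 / (pi * r\<^sup>2)))" if "0 < t" "t \<le> M" "\<theta> \<in> {0..1}" for t \<theta>
  proof -
    have t\<theta>: "0 \<le> t * \<theta>" "t * \<theta> \<le> t"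
      using that mult_left_mono[of \<theta> 1 t] by simp_all
    then have t\<theta>M: "t * \<theta> \<le> M" using that by linarith
    have "\<bar>h t \<theta>\<bar> = t * (exp (2 * (t * \<theta>)) * \<bar>clifford (t * \<theta> * (t - t * \<theta>))\<bar> * heat2 r (t * \<theta>))"
      using that by (simp add: h_def abs_mult heat2_nonneg)
    also have "\<dots> \<le> M * (exp (2 * M) * 1 * (1 / (pi * r\<^sup>2)))"
      using that t\<theta> t\<theta>M assms
      by (intro mult_mono abs_clifford_le_1 heat2_bounded mult_nonneg_nonneg heat2_nonneg) auto
    finally show ?thesis by simp
  qed
  have "(\<lambda>n. \<integral>\<theta>. indicator {0..1} \<theta> * h (x n) \<theta> \<partial>lborel) \<longlonglongrightarrow> (\<integral>\<theta>. indicator {0..1} \<theta> * h a \<theta> \<partial>lborel)"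
  proof (rule integral_dominated_convergence)
    show "integrable lborel (\<lambda>\<theta>. indicator {0..1::real} \<theta> * (M * (exp (2 * M) * (1 / (pi * r\<^sup>2)))))"
      by (intro integrable_mult_left) simp
    show "AE \<theta> in lborel. norm (indicator {0..1} \<theta> * h (x n) \<theta>)
        \<le> indicator {0..1} \<theta> * (M * (exp (2 * M) * (1 / (pi * r\<^sup>2))))" for n
    proof (intro AE_I2)
      fix \<theta> :: real
      show "norm (indicator {0..1} \<theta> * h (x n) \<theta>) \<le> indicator {0..1} \<theta> * (M * (exp (2 * M) * (1 / (pi * r\<^sup>2))))"
        using le[of "x n" \<theta>] x(1) M[of n] by (cases "\<theta> \<in> {0..1}") auto
    qed
    have lim: "(\<lambda>n. indicator {0..1} \<theta> * h (x n) \<theta>) \<longlonglongrightarrow> indicator {0..1} \<theta> * h a \<theta>" if "\<theta> \<noteq> 0" for \<theta>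
    proof (cases "\<theta> \<in> {0..1}")
      case True
      with that have \<theta>: "0 < \<theta>" by simp
      have pos: "0 < t * \<theta>" if "0 < t" for t using that \<theta> by simp
      have "continuous_on {0<..} (\<lambda>t. t * (exp (2 * (t * \<theta>)) * clifford (t * \<theta> * (t - t * \<theta>)) *
          (exp (- (r\<^sup>2 / (4 * (t * \<theta>)))) / (4 * pi * (t * \<theta>)))))"
        using \<theta> by (intro continuous_intros) auto
      then have "continuous_on {0<..} (\<lambda>t. h t \<theta>)"
        by (rule continuous_on_eq) (use pos in \<open>force simp: h_def heat2_def\<close>)
      then have "(\<lambda>n. h (x n) \<theta>) \<longlonglongrightarrow> h a \<theta>"
        using x a by (auto simp: continuous_on_sequentially comp_def)
      then show ?thesis by (rule tendsto_mult_left)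
    qed simp
    show "AE \<theta> in lborel. (\<lambda>n. indicator {0..1} \<theta> * h (x n) \<theta>) \<longlonglongrightarrow> indicator {0..1} \<theta> * h a \<theta>"
      using AE_lborel_singleton[of 0] by eventually_elim (rule lim)
  qed (unfold h_def, measurable)
  then show "(wave_kernel r \<circ> x) \<longlonglongrightarrow> wave_kernel r a"
    using x(1) a by (simp add: comp_def eq)
qed

lemma continuous_on_G1:
  assumes "0 < r"
  shows "continuous_on {0<..} (\<lambda>t. G1 t r)"
proof -
  have "continuous_on {0<..} (\<lambda>t. exp (- t) * wave_kernel r t)"
    by (intro continuous_intros continuous_on_wave_kernel assms)
  then show ?thesis
    by (rule continuous_on_eq) (simp add: G1_eq_wave_kernel assms)
qed

text \<open>For fixed r the bound of \<open>abs_G1_le\<close> is uniform for 0 < t \<le> T, so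
  boundedness and measurability suffice. K may contain t = 0, which that bound does not cover; the
  value there is carried along as a separate constant.\<close>

lemma set_integrable_G1:
  assumes "0 < r" "compact K" "K \<subseteq> {0..}"
  shows "set_integrable lborel K (\<lambda>t. G1 t r)"
proof -
  obtain T where T: "T > 0" "\<And>t. t \<in> K \<Longrightarrow> \<bar>t\<bar> \<le> T"
    using compact_imp_bounded[OF assms(2)] by (auto simp: bounded_pos)
  define M where "M = max (exp T * ((ln (4 * T + r\<^sup>2) - 2 * ln r) / (4 * pi))) \<bar>G1 0 r\<bar>"
  have [measurable]: "K \<in> sets borel" using assms(2) by (intro borel_closed compact_imp_closed)
  have [measurable]: "(\<lambda>t. indicator {0<..} t *\<^sub>R G1 t r) \<in> borel_measurable borel"
    by (intro borel_measurable_continuous_on_indicator continuous_on_G1 assms) auto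
  have split: "indicator K t *\<^sub>R G1 t r
      = indicator K t * (indicator {0<..} t *\<^sub>R G1 t r) + indicator (K \<inter> {0}) t * G1 0 r" for t
    using assms(3) by (cases "t = 0") (auto simp: indicator_def)
  show ?thesis
    unfolding set_integrable_def
  proof (rule Bochner_Integration.integrable_bound)
    show "integrable lborel (\<lambda>t. indicator {- T..T} t * M)"
      using T(1) by (intro integrable_mult_left) simp
    show "(\<lambda>t. indicator K t *\<^sub>R G1 t r) \<in> borel_measurable lborel"
      unfolding split by measurable
    have "norm (indicator K t *\<^sub>R G1 t r) \<le> norm (indicator {- T..T} t * M)" for t
    proof (cases "t \<in> K")
      case True
      then have t: "0 \<le> t" "t \<le> T" "- T \<le> t" using T(2)[OF True] assms(3) by auto
      have "\<bar>G1 t r\<bar> \<le> M"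
        using abs_G1_le[OF assms(1), of t T] t by (cases "t = 0") (auto simp: M_def le_max_iff_disj)
      with t True show ?thesis by simp
    qed simp
    then show "AE t in lborel. norm (indicator K t *\<^sub>R G1 t r) \<le> norm (indicator {- T..T} t * M)"
      by simp
  qed
qed

lemma G1_log_bound:
  assumes "T > 0"
  shows "\<exists>C>0. \<forall>t r. 0 < t \<and> t \<le> T \<and> 0 < r \<and> r \<le> 1 \<longrightarrow> \<bar>G1 t r\<bar> \<le> C * (1 + \<bar>ln r\<bar>)"
\<comment> \<open>The term 4 T + 1 comes from r^2 \<le> 1 and the 2 from ln (r^2) = 2 ln r; the
  factor 1 / (4 pi) is given away.\<close>
proof (intro exI[of _ "exp T * (ln (4 * T + 1) + 2)"] conjI allI impI)
  have L: "0 < ln (4 * T + 1)" using assms by simp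
  then show "0 < exp T * (ln (4 * T + 1) + 2)" by simp
  fix t r :: real
  assume *: "0 < t \<and> t \<le> T \<and> 0 < r \<and> r \<le> 1"
  then have "r\<^sup>2 \<le> 1" by (simp add: power_le_one)
  then have "ln (4 * T + r\<^sup>2) \<le> ln (4 * T + 1)"
    using assms by (intro ln_mono) (auto simp: add_pos_nonneg)
  moreover have "ln r = - \<bar>ln r\<bar>" using * by simp
  ultimately have "ln (4 * T + r\<^sup>2) - 2 * ln r \<le> ln (4 * T + 1) + 2 * \<bar>ln r\<bar>" by linarith
  also have "\<dots> \<le> (ln (4 * T + 1) + 2) * (1 + \<bar>ln r\<bar>)"
    using L by (simp add: algebra_simps)
  finally have le: "ln (4 * T + r\<^sup>2) - 2 * ln r \<le> (ln (4 * T + 1) + 2) * (1 + \<bar>ln r\<bar>)" .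
  have "\<bar>G1 t r\<bar> \<le> exp T * ((ln (4 * T + r\<^sup>2) - 2 * ln r) / (4 * pi))"
    using * by (intro abs_G1_le) auto
  also have "\<dots> \<le> exp T * ((ln (4 * T + 1) + 2) * (1 + \<bar>ln r\<bar>) / (4 * pi))"
    using le by (intro mult_left_mono divide_right_mono) auto
  also have "\<dots> \<le> exp T * ((ln (4 * T + 1) + 2) * (1 + \<bar>ln r\<bar>) / 1)"
    using L pi_gt3 by (intro mult_left_mono divide_left_mono) auto
  finally show "\<bar>G1 t r\<bar> \<le> exp T * (ln (4 * T + 1) + 2) * (1 + \<bar>ln r\<bar>)" by simp
qed

subsection \<open>Positivity from alternating differences of the Laplace transform\<close>

text \<open>The m-th power of identity minus unit shift, so complete monotonicity reads as
  nonnegativity without signs. Step 1 is chosen because on exp (- p t) it produces powers of 1 - x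
  with x = exp (-t), the second factor of the Bernstein basis.\<close>

fun bdiff :: "nat \<Rightarrow> (real \<Rightarrow> real) \<Rightarrow> real \<Rightarrow> real" where
  "bdiff 0 f p = f p"
| "bdiff (Suc m) f p = bdiff m f p - bdiff m f (p + 1)"

lemma has_bochner_integral_bdiff:
  assumes "\<And>p. p0 \<le> p \<Longrightarrow> has_bochner_integral M (\<lambda>s. E s p) (F p)" "p0 \<le> p"
  shows "has_bochner_integral M (\<lambda>s. bdiff m (E s) p) (bdiff m F p)"
  using assms(2) by (induction m arbitrary: p) (auto intro!: assms(1) has_bochner_integral_diff)

lemma bdiff_exp: "bdiff m (\<lambda>p. exp (- (p * t)) * c) p = exp (- (p * t)) * (1 - exp (- t)) ^ m * c"
  by (induction m arbitrary: p) (auto simp: algebra_simps exp_add[symmetric] mult_exp_exp)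

lemma bdiff_uminus: "bdiff m (\<lambda>p. - f p) p = - bdiff m f p"
  by (induction m arbitrary: p) auto

lemma DERIV_bdiff:
  assumes "\<And>p. 0 < p \<Longrightarrow> (f has_real_derivative f' p) (at p)" "0 < p"
  shows "(bdiff m f has_real_derivative bdiff m f' p) (at p)"
  using assms(2)
proof (induction m arbitrary: p)
  case 0
  then show ?case using assms(1) by (simp add: bdiff.simps(1)[abs_def])
next
  case (Suc m)
  have "((\<lambda>p. bdiff m f p - bdiff m f (p + 1)) has_real_derivative bdiff m f' p - bdiff m f' (p + 1)) (at p)"
    using Suc.prems by (intro DERIV_diff Suc.IH DERIV_shift[THEN iffD1]) auto
  then show ?case by (simp add: fun_eq_iff[of "bdiff (Suc m) f"] bdiff.simps(2)[abs_def])
qed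

text \<open>
  A cone of functions that is closed under \<open>- d/dp\<close>, because the derivative of
  \<open>p powr (1/2) - p powr (- 1/2)\<close> is \<open>p powr (- 1/2) / 2 + p powr (- 3/2) / 2\<close>.
\<close>

inductive exp_powr_cone :: "real \<Rightarrow> (real \<Rightarrow> real) \<Rightarrow> bool" for a where
  base: "0 \<le> c \<Longrightarrow> 0 \<le> b \<Longrightarrow>
    exp_powr_cone a (\<lambda>p. c * p powr (- b) * exp (- (a * (p powr (1 / 2) - p powr (- 1 / 2)))))"
| add: "exp_powr_cone a f \<Longrightarrow> exp_powr_cone a g \<Longrightarrow> exp_powr_cone a (\<lambda>p. f p + g p)"

lemma exp_powr_cone_nonneg: "exp_powr_cone a f \<Longrightarrow> 0 \<le> f p"
  by (induction rule: exp_powr_cone.induct) auto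

lemma exp_powr_cone_DERIV:
  assumes "0 \<le> a" "exp_powr_cone a f"
  shows "\<exists>g. exp_powr_cone a g \<and> (\<forall>p>0. (f has_real_derivative - g p) (at p))"
  using assms(2)
proof (induction rule: exp_powr_cone.induct)
  case (base c b)
  let ?e = "\<lambda>p. exp (- (a * (p powr (1 / 2) - p powr (- 1 / 2))))"
  \<comment> \<open>One term comes from the power and two from the exponent; their coefficients are
    nonnegative since a, b and c are.\<close>
  let ?g = "\<lambda>p. (c * b * p powr (- (b + 1)) * ?e p + c * a / 2 * p powr (- (b + 1 / 2)) * ?e p)
    + c * a / 2 * p powr (- (b + 3 / 2)) * ?e p"
  have "exp_powr_cone a ?g"
    using base assms(1) by (intro exp_powr_cone.intros) auto
  moreover have "((\<lambda>p. c * p powr (- b) * ?e p) has_real_derivative - ?g p) (at p)" if "p > 0" for p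
  proof -
    have 1: "p powr (- b) * p powr (- 1 / 2) = p powr (- (b + 1 / 2))"
      "p powr (- b) * p powr (- 3 / 2) = p powr (- (b + 3 / 2))"
      by (simp_all flip: powr_add)
    have 2: "- b - 1 = - (b + 1)" by simp
    have "((\<lambda>p. c * p powr (- b) * ?e p) has_real_derivative
        c * (- b * p powr (- b - 1)) * ?e p
        + c * p powr (- b) * (?e p * - (a * (1 / 2 * p powr (- 1 / 2) + 1 / 2 * p powr (- 3 / 2))))) (at p)"
      using that by (auto intro!: derivative_eq_intros simp: field_simps)
    also have "c * (- b * p powr (- b - 1)) * ?e p
        + c * p powr (- b) * (?e p * - (a * (1 / 2 * p powr (- 1 / 2) + 1 / 2 * p powr (- 3 / 2))))
       = - (c * b * p powr (- (b + 1)) * ?e p + c * a / 2 * (p powr (- b) * p powr (- 1 / 2)) * ?e p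
         + c * a / 2 * (p powr (- b) * p powr (- 3 / 2)) * ?e p)"
      unfolding 2 by (simp add: algebra_simps)
    finally show ?thesis unfolding 1 .
  qed
  ultimately show ?case by (intro exI[of _ ?g]) blast
next
  case (add f g)
  then obtain f' g' where "exp_powr_cone a f'" "\<forall>p>0. (f has_real_derivative - f' p) (at p)"
    "exp_powr_cone a g'" "\<forall>p>0. (g has_real_derivative - g' p) (at p)"
    by blast
  then show ?case
    by (intro exI[of _ "\<lambda>p. f' p + g' p"])
      (auto intro!: exp_powr_cone.add derivative_eq_intros)
qed

text \<open>Minus the derivative of \<open>bdiff m f\<close> is \<open>bdiff m g\<close> with g
  again in the cone. By induction it is nonnegative, so \<open>bdiff m f\<close> decreases from p to
  p + 1, which is the next difference.\<close>

lemma bdiff_exp_powr_cone_nonneg: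
  assumes "0 \<le> a" "exp_powr_cone a f" "0 < p"
  shows "0 \<le> bdiff m f p"
  using assms(2,3)
proof (induction m arbitrary: f p)
  case (Suc m)
  obtain g where g: "exp_powr_cone a g" "\<And>p. 0 < p \<Longrightarrow> (f has_real_derivative - g p) (at p)"
    using exp_powr_cone_DERIV[OF assms(1) Suc.prems(1)] by blast
  have "bdiff m f (p + 1) \<le> bdiff m f p"
  proof (rule DERIV_nonpos_imp_nonincreasing[of p "p + 1" "bdiff m f"])
    fix x assume "p \<le> x"
    then have "0 < x" using Suc.prems by simp
    then show "\<exists>y. (bdiff m f has_real_derivative y) (at x) \<and> y \<le> 0"
      using DERIV_bdiff[OF g(2), of x m] Suc.IH[OF g(1), of x]
      by (auto simp: bdiff_uminus)
  qed simp
  then show ?case by simp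
qed (simp add: exp_powr_cone_nonneg)

text \<open>
  A Hausdorff moment argument: by assumption \<open>h\<close> has nonnegative integrals against
  \<open>exp (- p t) (1 - exp (- t)) ^ m\<close>, hence against Bernstein polynomials in \<open>exp (- t)\<close>.
\<close>

lemma nonneg_if_bdiff_Laplace_nonneg:
  fixes h F :: "real \<Rightarrow> real"
  assumes cont: "continuous_on {0<..} h" and zero: "\<And>t. t < 0 \<Longrightarrow> h t = 0"
    and laplace: "\<And>p. p0 \<le> p \<Longrightarrow> has_bochner_integral lborel (\<lambda>t. exp (- (p * t)) * h t) (F p)"
    and alternating: "\<And>m p. p0 \<le> p \<Longrightarrow> 0 \<le> bdiff m F p"
    and "0 < t0"
  shows "0 \<le> h t0"
proof (rule ccontr)
  assume "\<not> 0 \<le> h t0"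
  define w where "w = (\<lambda>t. exp (- (p0 * t)) * h t)"
  have w: "integrable lborel w"
    using laplace[of p0] by (auto simp: w_def has_bochner_integral_iff)
  have moment: "has_bochner_integral lborel (\<lambda>t. w t * (exp (- t) ^ k * (1 - exp (- t)) ^ m)) (bdiff m F (p0 + k))"
    for k m
  proof -
    have "has_bochner_integral lborel (\<lambda>t. bdiff m (\<lambda>p. exp (- (p * t)) * h t) (p0 + k)) (bdiff m F (p0 + k))"
      using laplace by (rule has_bochner_integral_bdiff) auto
    moreover have "bdiff m (\<lambda>p. exp (- (p * t)) * h t) (p0 + k) = w t * (exp (- t) ^ k * (1 - exp (- t)) ^ m)" for t
    proof -
      have eq: "exp (- ((p0 + k) * t)) = exp (- (p0 * t)) * exp (- t) ^ k"
        by (simp add: algebra_simps flip: exp_of_nat_mult exp_add)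
      have "bdiff m (\<lambda>p. exp (- (p * t)) * h t) (p0 + k) = exp (- ((p0 + k) * t)) * (1 - exp (- t)) ^ m * h t"
        by (rule bdiff_exp)
      also have "\<dots> = w t * (exp (- t) ^ k * (1 - exp (- t)) ^ m)"
        by (subst eq) (simp add: w_def)
      finally show ?thesis .
    qed
    ultimately show ?thesis by (simp only:)
  qed
  have weighted: "0 \<le> (\<integral>t. w t * \<phi> (exp (- t)) \<partial>lborel)"
    if \<phi>: "continuous_on UNIV \<phi>" "\<And>x. 0 \<le> \<phi> x" "\<And>x. x \<in> {0..1} \<Longrightarrow> \<phi> x \<le> 1" for \<phi> :: "real \<Rightarrow> real"
  proof (rule field_le_epsilon)
    fix e :: real assume "e > 0"
    define W where "W = (\<integral>t. norm (w t) \<partial>lborel)"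
    have W: "0 \<le> W" by (simp add: W_def)
    \<comment> \<open>The 1 avoids division by zero when W = 0.\<close>
    define d where "d = e / (W + 1)"
    have d: "d > 0" "d * W \<le> e"
      using \<open>e > 0\<close> W by (auto simp: d_def field_simps)
    obtain n where n: "\<And>x. x \<in> {0..1} \<Longrightarrow> \<bar>\<phi> x - (\<Sum>k\<le>n. \<phi> (k / n) * Bernstein n k x)\<bar> < d"
      using Bernstein_Weierstrass[OF continuous_on_subset[OF \<phi>(1)] d(1)] by blast
    define P where "P = (\<lambda>x. \<Sum>k\<le>n. \<phi> (k / n) * Bernstein n k x)"
    have P: "has_bochner_integral lborel (\<lambda>t. w t * P (exp (- t)))
        (\<Sum>k\<le>n. \<phi> (k / n) * (n choose k) * bdiff (n - k) F (p0 + k))"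
    proof -
      have "has_bochner_integral lborel (\<lambda>t. \<Sum>k\<le>n. \<phi> (k / n) * (n choose k) * (w t * (exp (- t) ^ k * (1 - exp (- t)) ^ (n - k))))
        (\<Sum>k\<le>n. \<phi> (k / n) * (n choose k) * bdiff (n - k) F (p0 + k))"
        by (intro has_bochner_integral_sum has_bochner_integral_mult_right moment)
      moreover have "(\<Sum>k\<le>n. \<phi> (k / n) * (n choose k) * (w t * (exp (- t) ^ k * (1 - exp (- t)) ^ (n - k))))
          = w t * P (exp (- t))" for t
        by (simp add: P_def Bernstein_def sum_distrib_left mult_ac)
      ultimately show ?thesis by simp
    qed
    have \<phi>_meas[measurable]: "\<phi> \<in> borel_measurable borel"
      using \<phi>(1) by (rule borel_measurable_continuous_onI)
    \<comment> \<open>For t < 0 the point exp (-t) leaves \<open>{0..1}\<close>, where neither the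
      bound on \<phi> nor the Bernstein approximation holds.\<close>
    have w_neg: "w t = 0" if "t < 0" for t using zero[OF that] by (simp add: w_def)
    have int: "integrable lborel (\<lambda>t. w t * \<phi> (exp (- t)))"
    proof (rule Bochner_Integration.integrable_bound[OF w])
      show "AE t in lborel. norm (w t * \<phi> (exp (- t))) \<le> norm (w t)"
      proof (intro AE_I2)
        fix t show "norm (w t * \<phi> (exp (- t))) \<le> norm (w t)"
          using \<phi>(2)[of "exp (- t)"] \<phi>(3)[of "exp (- t)"] w_neg[of t]
          by (cases "t < 0") (auto simp: abs_mult intro!: mult_left_le)
      qed
    qed (use w in measurable)
    have "0 \<le> (\<integral>t. w t * P (exp (- t)) \<partial>lborel)"
      using alternating \<phi>(2) by (subst has_bochner_integral_integral_eq[OF P]) (auto intro!: sum_nonneg)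
    also have "\<dots> \<le> (\<integral>t. w t * \<phi> (exp (- t)) + d * norm (w t) \<partial>lborel)"
    proof (rule integral_mono)
      fix t
      show "w t * P (exp (- t)) \<le> w t * \<phi> (exp (- t)) + d * norm (w t)"
      proof (cases "t < 0")
        case False
        then have "\<bar>\<phi> (exp (- t)) - P (exp (- t))\<bar> \<le> d"
          using n[of "exp (- t)"] by (simp add: P_def)
        then have "\<bar>w t\<bar> * \<bar>\<phi> (exp (- t)) - P (exp (- t))\<bar> \<le> \<bar>w t\<bar> * d"
          by (intro mult_left_mono) auto
        then have "\<bar>w t * \<phi> (exp (- t)) - w t * P (exp (- t))\<bar> \<le> d * norm (w t)"
          by (simp add: abs_mult right_diff_distrib[symmetric] mult.commute)
        then show ?thesis by linarith
      qed (simp add: w_neg)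
    qed (use P int w in \<open>auto simp: has_bochner_integral_iff\<close>)
    also have "\<dots> = (\<integral>t. w t * \<phi> (exp (- t)) \<partial>lborel) + d * W"
      using int w by (simp add: W_def)
    also have "\<dots> \<le> (\<integral>t. w t * \<phi> (exp (- t)) \<partial>lborel) + e"
      using d(2) by simp
    finally show "0 \<le> (\<integral>t. w t * \<phi> (exp (- t)) \<partial>lborel) + e" .
  qed
  have "\<exists>d>0. d < t0 \<and> (\<forall>t. t0 - d < t \<and> t < t0 + d \<longrightarrow> h t < 0)"
  proof -
    have "isCont h t0"
      using cont \<open>0 < t0\<close> by (simp add: continuous_on_eq_continuous_at)
    then have "\<forall>\<^sub>F t in at t0. h t < 0"
      using \<open>\<not> 0 \<le> h t0\<close> by (intro order_tendstoD(2)) (auto simp: isCont_def)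
    then obtain d where d: "d > 0" "\<And>t. t \<noteq> t0 \<Longrightarrow> dist t t0 < d \<Longrightarrow> h t < 0"
      by (auto simp: eventually_at)
    have "h t < 0" if "t0 - min d (t0 / 2) < t" "t < t0 + min d (t0 / 2)" for t
      using d(2)[of t] that \<open>\<not> 0 \<le> h t0\<close> by (cases "t = t0") (auto simp: dist_real_def)
    then show ?thesis
      using d(1) \<open>0 < t0\<close> by (intro exI[of _ "min d (t0 / 2)"] conjI allI impI) auto
  qed
  then obtain d where d: "d > 0" "d < t0" "\<And>t. t0 - d < t \<Longrightarrow> t < t0 + d \<Longrightarrow> h t < 0"
    by blast
  \<comment> \<open>A bump in the variable exp (-t), positive exactly for |t - t0| < d. The
    exponential reverses the order, so \<alpha> belongs to the right endpoint; d < t0 keeps \<beta>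
    below 1.\<close>
  define \<alpha> \<beta> where "\<alpha> = exp (- (t0 + d))" and "\<beta> = exp (- (t0 - d))"
  define \<phi> where "\<phi> = (\<lambda>x. max 0 ((x - \<alpha>) * (\<beta> - x)))"
  have \<phi>_pos: "\<phi> (exp (- t)) > 0 \<longleftrightarrow> t0 - d < t \<and> t < t0 + d" for t
  proof -
    have "\<phi> (exp (- t)) > 0 \<longleftrightarrow> (exp (- t) - \<alpha>) * (\<beta> - exp (- t)) > 0"
      by (simp add: \<phi>_def less_max_iff_disj)
    also have "\<dots> \<longleftrightarrow> t0 - d < t \<and> t < t0 + d"
      using d(1) by (auto simp: zero_less_mult_iff \<alpha>_def \<beta>_def)
    finally show ?thesis .
  qed
  have \<phi>_nonneg: "0 \<le> \<phi> x" for x by (simp add: \<phi>_def)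
  have \<phi>_cont: "continuous_on UNIV \<phi>" unfolding \<phi>_def by (intro continuous_intros)
  have \<phi>_le: "\<phi> x \<le> 1" if "x \<in> {0..1}" for x
  proof -
    have "\<alpha> \<in> {0..1}" "\<beta> \<in> {0..1}" using d by (auto simp: \<alpha>_def \<beta>_def)
    then have "\<bar>(x - \<alpha>) * (\<beta> - x)\<bar> \<le> 1 * 1"
      using that unfolding abs_mult by (intro mult_mono) auto
    then show ?thesis by (simp add: \<phi>_def)
  qed
  have neg: "w t * \<phi> (exp (- t)) \<le> 0" for t
  proof (cases "\<phi> (exp (- t)) > 0")
    case True
    then have "h t < 0" using d(3) \<phi>_pos by blast
    then show ?thesis using True by (simp add: w_def mult_nonpos_nonneg mult_nonneg_nonpos)
  next
    case False
    then have "\<phi> (exp (- t)) = 0" using \<phi>_nonneg[of "exp (- t)"] by simp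
    then show ?thesis by simp
  qed
  have [measurable]: "\<phi> \<in> borel_measurable borel"
    using \<phi>_cont by (rule borel_measurable_continuous_onI)
  have int: "integrable lborel (\<lambda>t. - (w t * \<phi> (exp (- t))))"
  proof (rule Bochner_Integration.integrable_bound[OF w])
    show "AE t in lborel. norm (- (w t * \<phi> (exp (- t)))) \<le> norm (w t)"
    proof (intro AE_I2)
      fix t show "norm (- (w t * \<phi> (exp (- t)))) \<le> norm (w t)"
        using \<phi>_nonneg[of "exp (- t)"] \<phi>_le[of "exp (- t)"] zero[of t]
        by (cases "t < 0") (auto simp: abs_mult w_def intro!: mult_left_le)
    qed
  qed (use w in measurable)
  \<comment> \<open>The moment argument makes this integral nonpositive and the sign of h near t0
    makes the integrand nonnegative. Hence the integrand vanishes almost everywhere, although it is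
    positive on an interval.\<close>
  have "(\<integral>t. - (w t * \<phi> (exp (- t))) \<partial>lborel) = 0"
    using weighted[OF \<phi>_cont \<phi>_nonneg \<phi>_le] neg
    by (intro antisym integral_nonneg_AE) auto
  then have "AE t in lborel. - (w t * \<phi> (exp (- t))) = 0"
    using integral_nonneg_eq_0_iff_AE[OF int] neg by simp
  then have "AE t in lborel. t \<notin> {t0 - d<..<t0 + d}"
  proof eventually_elim
    case (elim t)
    show ?case
    proof
      assume "t \<in> {t0 - d<..<t0 + d}"
      then have "\<phi> (exp (- t)) > 0" "h t < 0" using d(3) \<phi>_pos by auto
      then show False using elim by (simp add: w_def)
    qed
  qed
  then have "emeasure lborel {t0 - d<..<t0 + d} = 0"
    by (subst (asm) AE_iff_measurable[of "{t0 - d<..<t0 + d}"]) auto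
  then show False using d(1) by simp
qed

subsection \<open>The Laplace transform of the kernel\<close>

text \<open>The bounds cosh s \<ge> (1 + s^2) / 4 and exp y \<ge> y give a multiple of 1 / (1 + s^2)
  as majorant.\<close>

lemma integrable_exp_cosh:
  assumes "0 < (a::real)"
  shows "integrable lborel (\<lambda>s. exp (- (a * cosh s)))"
proof (rule Bochner_Integration.integrable_bound)
  have "integrable lborel (\<lambda>s::real. inverse (1 + s\<^sup>2))"
    using integrable_inverse_1_plus_square by (simp add: set_integrable_def)
  then show "integrable lborel (\<lambda>s::real. 4 / a * inverse (1 + s\<^sup>2))"
    by (rule integrable_mult_right)
  have "exp (- (a * cosh s)) \<le> 4 / a * inverse (1 + s\<^sup>2)" for s
  proof -
    have "1 + s\<^sup>2 \<le> 4 * cosh s"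
    proof -
      have "1 + \<bar>s\<bar> + s\<^sup>2 / 2 \<le> exp \<bar>s\<bar>"
        using exp_lower_Taylor_quadratic[of "\<bar>s\<bar>"] by simp
      also have "\<dots> \<le> 2 * cosh s"
        unfolding cosh_field_def by (cases "0 \<le> s") auto
      finally show ?thesis using abs_ge_zero[of s] by linarith
    qed
    then have "a * (1 + s\<^sup>2) \<le> 4 * (a * cosh s)" using assms by simp
    also have "\<dots> \<le> 4 * exp (a * cosh s)" using exp_ge_add_one_self[of "a * cosh s"] by linarith
    finally have le: "a * (1 + s\<^sup>2) \<le> 4 * exp (a * cosh s)" .
    have "0 < a * (1 + s\<^sup>2)" using assms by (intro mult_pos_pos add_pos_nonneg) auto
    with le have "4 / (4 * exp (a * cosh s)) \<le> 4 / (a * (1 + s\<^sup>2))"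
      by (intro divide_left_mono) auto
    then show ?thesis by (simp add: exp_minus inverse_eq_divide)
  qed
  then show "AE s in lborel. norm (exp (- (a * cosh s))) \<le> norm (4 / a * inverse (1 + s\<^sup>2))"
    using assms by (intro AE_I2) simp
qed (unfold cosh_field_def, measurable)

text \<open>Both integrals represent \<open>K\<^sub>0 (r x) / (2 \<pi>)\<close>; they are related by \<open>u = r / (2 x) * exp s\<close>.\<close>

lemma has_bochner_integral_Laplace_heat2:
  assumes "0 < r" "0 < x"
  shows "has_bochner_integral lborel (\<lambda>u. exp (- (x\<^sup>2 * u)) * heat2 r u)
    (\<integral>s. 1 / (4 * pi) * exp (- (r * x * cosh s)) \<partial>lborel)"
proof -
  define f where "f = (\<lambda>u. exp (- (x\<^sup>2 * u)) * (exp (- (r\<^sup>2 / (4 * u))) / (4 * pi * u)))"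
  \<comment> \<open>At u = r / (2 x) the exponents x^2 u and r^2 / (4 u) agree. They become r x / 2
    times exp s and exp (-s), with sum r x cosh s, and 1 / u cancels against du = u ds.\<close>
  define g where "g = (\<lambda>s. r / (2 * x) * exp s)"
  have g_pos: "0 < g s" for s using assms by (simp add: g_def)
  have fg: "f (g s) * g s = 1 / (4 * pi) * exp (- (r * x * cosh s))" for s
  proof -
    have "x\<^sup>2 * g s = r * x / 2 * exp s" "r\<^sup>2 / (4 * g s) = r * x / 2 * exp (- s)"
      using assms by (simp_all add: g_def exp_minus power2_eq_square field_simps)
    then have "- (x\<^sup>2 * g s) + - (r\<^sup>2 / (4 * g s)) = - (r * x * cosh s)"
      by (simp add: cosh_field_def field_simps)
    then have "exp (- (x\<^sup>2 * g s)) * exp (- (r\<^sup>2 / (4 * g s))) = exp (- (r * x * cosh s))"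
      by (simp flip: exp_add)
    then show ?thesis using g_pos[of s] by (simp add: f_def)
  qed
  have int: "integrable lborel (\<lambda>s. 1 / (4 * pi) * exp (- (r * x * cosh s)))"
    using assms by (intro integrable_mult_right integrable_exp_cosh) simp
  have g_lim: "(g \<longlongrightarrow> 0) at_bot" "filterlim g at_top at_top"
  proof -
    have "(g \<longlongrightarrow> r / (2 * x) * 0) at_bot"
      unfolding g_def by (intro tendsto_mult tendsto_const exp_at_bot)
    then show "(g \<longlongrightarrow> 0) at_bot" by simp
    show "filterlim g at_top at_top"
      unfolding g_def using assms
      by (intro filterlim_tendsto_pos_mult_at_top[OF tendsto_const] exp_at_top) auto
  qed
  have deriv: "DERIV g s :> g s" for s
    unfolding g_def using assms by (auto intro!: derivative_eq_intros)
  have cont: "isCont f (g s)" for s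
    unfolding f_def using g_pos[of s] assms by (intro continuous_intros) auto
  have nonneg: "0 \<le> f (g s)" for s
    using g_pos[of s] by (simp add: f_def)
  have g_lim': "((ereal \<circ> g \<circ> real_of_ereal) \<longlongrightarrow> 0) (at_right (- \<infinity>))"
    "((ereal \<circ> g \<circ> real_of_ereal) \<longlongrightarrow> \<infinity>) (at_left \<infinity>)"
    using g_lim by (simp_all add: ereal_tendsto_simps zero_ereal_def)
  have int': "set_integrable lborel (einterval (- \<infinity>) \<infinity>) (\<lambda>s. f (g s) * g s)"
    using int by (simp add: fg set_integrable_def)
  have "(- \<infinity> :: ereal) < \<infinity>" by simp
  note subst = interval_integral_substitution_nonneg[OF this deriv cont DERIV_isCont[OF deriv] nonneg
      less_imp_le[OF g_pos] g_lim' int']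
  have "integrable lborel (\<lambda>u. indicator {0<..} u *\<^sub>R f u)"
    using subst(1) by (simp add: zero_ereal_def set_integrable_def)
  moreover have "(\<integral>u. indicator {0<..} u *\<^sub>R f u \<partial>lborel) = (\<integral>s. 1 / (4 * pi) * exp (- (r * x * cosh s)) \<partial>lborel)"
    using subst(2) by (simp add: zero_ereal_def set_lebesgue_integral_def fg interval_lebesgue_integral_def)
  moreover have "indicator {0<..} u *\<^sub>R f u = exp (- (x\<^sup>2 * u)) * heat2 r u" for u
    by (simp add: f_def heat2_def indicator_def)
  ultimately show ?thesis
    by (simp only: has_bochner_integral_iff)
qed

lemma integrable_exp_Ici:
  assumes "0 < (q::real)"
  shows "integrable lborel (\<lambda>x. indicator {0..} x * exp (- (q * x)))"
    and "(\<integral>x. indicator {0..} x * exp (- (q * x)) \<partial>lborel) = 1 / q"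
  using has_bochner_integral_Laplace_clifford[OF assms, of 0] by (auto simp: has_bochner_integral_iff)

text \<open>Fubini on 0 < u \<le> t: shifting t by u splits off exp (- p u), and the Laplace
  transform of the oscillating factor gives exp (- u / p) / p. Absolute convergence uses only that
  this factor is at most 1 in modulus, which leaves exp (- (p - 2) u) and explains p > 2.\<close>

lemma has_bochner_integral_Laplace_wave_kernel:
  assumes "0 < r" "2 < p"
  shows "has_bochner_integral lborel (\<lambda>t. exp (- (p * t)) * wave_kernel r t)
    (\<integral>u. 1 / p * (exp (- ((p - 2 + 1 / p) * u)) * heat2 r u) \<partial>lborel)"
proof -
  define \<Phi> where "\<Phi> = (\<lambda>(u, t). exp (2 * u) * heat2 r u * (indicator {u..} t * exp (- (p * t)) * clifford (u * (t - u))))"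
  have [measurable]: "\<Phi> \<in> borel_measurable (lborel \<Otimes>\<^sub>M lborel)"
  proof -
    \<comment> \<open>The set \<open>{u..}\<close> moves with u, so joint measurability is read off
      from the relation u \<le> t.\<close>
    have eq: "\<Phi> = (\<lambda>(u, t). exp (2 * u) * heat2 r u * ((if u \<le> t then 1 else 0) * exp (- (p * t)) * clifford (u * (t - u))))"
      by (auto simp: \<Phi>_def indicator_def fun_eq_iff)
    show ?thesis unfolding eq by measurable
  qed
  have shift: "has_bochner_integral lborel (\<lambda>t. indicator {u..} t * exp (- (p * t)) * f (t - u)) (exp (- (p * u)) * y)"
    if "has_bochner_integral lborel (\<lambda>x. indicator {0..} x * exp (- (p * x)) * f x) y" for f :: "real \<Rightarrow> real" and u y
  proof -
    have "has_bochner_integral lborel (\<lambda>t. exp (- (p * u)) * (indicator {0..} (- u + 1 * t) * exp (- (p * (- u + 1 * t))) * f (- u + 1 * t)))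
        (exp (- (p * u)) * y)"
      using lborel_has_bochner_integral_real_affine_iff[of 1 "\<lambda>x. indicator {0..} x * exp (- (p * x)) * f x" y "- u"] that
      by (intro has_bochner_integral_mult_right) simp
    moreover have "exp (- (p * u)) * (indicator {0..} (- u + 1 * t) * exp (- (p * (- u + 1 * t))) * f (- u + 1 * t))
        = indicator {u..} t * exp (- (p * t)) * f (t - u)" for t
    proof -
      have "exp (- (p * t)) = exp (- (p * u)) * exp (- (p * (- u + 1 * t)))"
        by (simp add: algebra_simps flip: exp_add)
      then show ?thesis by (simp add: indicator_def)
    qed
    ultimately show ?thesis by (simp only:)
  qed
  have inner: "has_bochner_integral lborel (\<lambda>t. \<Phi> (u, t)) (1 / p * (exp (- ((p - 2 + 1 / p) * u)) * heat2 r u))" for u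
  proof -
    have "has_bochner_integral lborel (\<lambda>t. \<Phi> (u, t)) (exp (2 * u) * heat2 r u * (exp (- (p * u)) * (1 / p * exp (- (u / p)))))"
      unfolding \<Phi>_def prod.case using assms
      by (intro has_bochner_integral_mult_right shift[where f = "\<lambda>x. clifford (u * x)"]
          has_bochner_integral_Laplace_clifford) auto
    moreover have "exp (2 * u) * heat2 r u * (exp (- (p * u)) * (1 / p * exp (- (u / p))))
        = 1 / p * ((exp (2 * u) * exp (- (p * u)) * exp (- (u / p))) * heat2 r u)"
      by simp
    moreover have "exp (2 * u) * exp (- (p * u)) * exp (- (u / p)) = exp (- ((p - 2 + 1 / p) * u))"
      by (simp add: algebra_simps flip: exp_add)
    ultimately show ?thesis by (simp only:)
  qed
  have abs_inner: "(\<integral>t. norm (\<Phi> (u, t)) \<partial>lborel) \<le> 1 / (pi * r\<^sup>2) * (1 / p) * (indicator {0..} u * exp (- ((p - 2) * u)))" for u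
  proof (cases "0 \<le> u")
    case True
    have one: "has_bochner_integral lborel (\<lambda>t. indicator {u..} t * exp (- (p * t)) * 1) (exp (- (p * u)) * (1 / p))"
      using integrable_exp_Ici[of p] assms by (intro shift[where f = "\<lambda>_. 1"]) (simp add: has_bochner_integral_iff)
    have "(\<integral>t. norm (\<Phi> (u, t)) \<partial>lborel) \<le> (\<integral>t. exp (2 * u) * heat2 r u * (indicator {u..} t * exp (- (p * t)) * 1) \<partial>lborel)"
    proof (rule integral_mono)
      show "norm (\<Phi> (u, t)) \<le> exp (2 * u) * heat2 r u * (indicator {u..} t * exp (- (p * t)) * 1)" for t
      proof (cases "u \<le> t")
        case ut: True
        have "exp (2 * u) * heat2 r u * (1 * exp (- (p * t)) * \<bar>clifford (u * (t - u))\<bar>)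
            \<le> exp (2 * u) * heat2 r u * (1 * exp (- (p * t)) * 1)"
          using True ut by (intro mult_left_mono abs_clifford_le_1 mult_nonneg_nonneg heat2_nonneg) auto
        then show ?thesis using ut by (simp add: \<Phi>_def abs_mult heat2_nonneg)
      qed (simp add: \<Phi>_def)
    qed (use inner one in \<open>auto simp: has_bochner_integral_iff\<close>)
    also have "\<dots> = exp (2 * u) * heat2 r u * (exp (- (p * u)) * (1 / p))"
      using one by (intro has_bochner_integral_integral_eq has_bochner_integral_mult_right)
    also have "\<dots> = heat2 r u * (1 / p) * exp (- ((p - 2) * u))"
    proof -
      have "exp (2 * u) * exp (- (p * u)) = exp (- ((p - 2) * u))"
        by (simp add: algebra_simps flip: exp_add)
      from arg_cong[OF this, of "\<lambda>y. heat2 r u * (1 / p) * y"] show ?thesis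
        by (simp add: mult_ac)
    qed
    also have "\<dots> \<le> 1 / (pi * r\<^sup>2) * (1 / p) * exp (- ((p - 2) * u))"
      using assms by (intro mult_right_mono heat2_bounded) auto
    finally show ?thesis using True by simp
  qed (simp add: \<Phi>_def heat2_def)
  have \<Phi>: "integrable (lborel \<Otimes>\<^sub>M lborel) \<Phi>"
  proof (rule lborel_pair.Fubini_integrable)
    show "AE u in lborel. integrable lborel (\<lambda>t. \<Phi> (u, t))"
      using inner by (simp add: has_bochner_integral_iff)
    show "integrable lborel (\<lambda>u. \<integral>t. norm (\<Phi> (u, t)) \<partial>lborel)"
    proof (rule Bochner_Integration.integrable_bound)
      show "integrable lborel (\<lambda>u. 1 / (pi * r\<^sup>2) * (1 / p) * (indicator {0..} u * exp (- ((p - 2) * u))))"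
        using assms by (intro integrable_mult_right integrable_exp_Ici) simp
      have norm_mono: "0 \<le> a \<Longrightarrow> a \<le> b \<Longrightarrow> norm a \<le> norm b" for a b :: real by simp
      show "AE u in lborel. norm (\<integral>t. norm (\<Phi> (u, t)) \<partial>lborel)
          \<le> norm (1 / (pi * r\<^sup>2) * (1 / p) * (indicator {0..} u * exp (- ((p - 2) * u))))"
        by (intro AE_I2 norm_mono abs_inner) simp
    qed measurable
  qed measurable
  have outer: "(\<integral>u. \<Phi> (u, t) \<partial>lborel) = exp (- (p * t)) * wave_kernel r t" for t
  proof -
    have "(\<integral>u. \<Phi> (u, t) \<partial>lborel) = (\<integral>u. exp (- (p * t)) * (indicator {0..t} u *\<^sub>R (exp (2 * u) * clifford (u * (t - u)) * heat2 r u)) \<partial>lborel)"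
      by (intro Bochner_Integration.integral_cong) (auto simp: \<Phi>_def indicator_def heat2_def)
    then show ?thesis by (simp add: wave_kernel_def set_lebesgue_integral_def)
  qed
  have "integrable lborel (\<lambda>t. \<integral>u. \<Phi> (u, t) \<partial>lborel)"
    using lborel_pair.integrable_snd[of "\<lambda>u t. \<Phi> (u, t)"] \<Phi> by simp
  moreover have "(\<integral>t. (\<integral>u. \<Phi> (u, t) \<partial>lborel) \<partial>lborel) = (\<integral>u. (\<integral>t. \<Phi> (u, t) \<partial>lborel) \<partial>lborel)"
    using lborel_pair.Fubini_integral[of "\<lambda>u t. \<Phi> (u, t)"] \<Phi> by simp
  moreover have "(\<integral>u. (\<integral>t. \<Phi> (u, t) \<partial>lborel) \<partial>lborel) = (\<integral>u. 1 / p * (exp (- ((p - 2 + 1 / p) * u)) * heat2 r u) \<partial>lborel)"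
    using has_bochner_integral_integral_eq[OF inner] by simp
  ultimately show ?thesis
    unfolding outer by (simp add: has_bochner_integral_iff)
qed

lemma wave_kernel_nonneg:
  assumes "0 < r" "0 < t"
  shows "0 \<le> wave_kernel r t"
proof -
  define \<phi> where "\<phi> = (\<lambda>p::real. p powr (1 / 2) - p powr (- 1 / 2))"
  define E where "E = (\<lambda>s p. 1 / (4 * pi) * p powr (- 1) * exp (- (r * cosh s * \<phi> p)))"
  define F where "F = (\<lambda>p. \<integral>s. E s p \<partial>lborel)"
  have \<phi>_pos: "0 < \<phi> p" if "1 < p" for p
    using that powr_less_mono[of "- 1 / 2" "1 / 2" p] by (simp add: \<phi>_def)
  have \<phi>_square: "(\<phi> p)\<^sup>2 = p - 2 + 1 / p" if "0 < p" for p
  proof -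
    have "(\<phi> p)\<^sup>2 = p powr (1 / 2) * p powr (1 / 2) - 2 * (p powr (1 / 2) * p powr (- 1 / 2)) + p powr (- 1 / 2) * p powr (- 1 / 2)"
      by (simp add: \<phi>_def power2_eq_square algebra_simps)
    also have "\<dots> = p - 2 + 1 / p"
      using that by (simp add: powr_minus_divide flip: powr_add)
    finally show ?thesis .
  qed
  have E: "has_bochner_integral lborel (\<lambda>s. E s p) (F p)" if "1 < p" for p
  proof -
    have "integrable lborel (\<lambda>s. 1 / (4 * pi) * p powr (- 1) * exp (- (r * \<phi> p * cosh s)))"
      using assms \<phi>_pos[OF that] by (intro integrable_mult_right integrable_exp_cosh) simp
    then show ?thesis by (simp add: F_def E_def has_bochner_integral_iff mult_ac)
  qed
  have cone: "exp_powr_cone (r * cosh s) (E s)" for s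
    unfolding E_def \<phi>_def by (rule exp_powr_cone.base) auto
  show ?thesis
  \<comment> \<open>Any threshold above 2 serves: the Laplace integral needs p > 2, and \<phi> is
    positive already for p > 1. The differences are taken under the s-integral, for each s in the
    cone with a = r cosh s.\<close>
  proof (rule nonneg_if_bdiff_Laplace_nonneg[of "wave_kernel r" 3 F])
    show "has_bochner_integral lborel (\<lambda>t. exp (- (p * t)) * wave_kernel r t) (F p)" if "3 \<le> p" for p
    proof -
      have "(\<integral>u. 1 / p * (exp (- ((p - 2 + 1 / p) * u)) * heat2 r u) \<partial>lborel)
          = 1 / p * (\<integral>u. exp (- ((\<phi> p)\<^sup>2 * u)) * heat2 r u \<partial>lborel)"
        using that by (simp add: \<phi>_square)
      also have "\<dots> = 1 / p * (\<integral>s. 1 / (4 * pi) * exp (- (r * \<phi> p * cosh s)) \<partial>lborel)"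
        using has_bochner_integral_integral_eq[OF has_bochner_integral_Laplace_heat2[of r "\<phi> p"]]
          assms(1) \<phi>_pos[of p] that by simp
      also have "\<dots> = F p"
        using that by (simp add: F_def E_def powr_minus_divide mult_ac)
      finally show ?thesis
        using has_bochner_integral_Laplace_wave_kernel[OF assms(1), of p] that by simp
    qed
    show "0 \<le> bdiff m F p" if "3 \<le> p" for m p
    proof -
      have int: "has_bochner_integral lborel (\<lambda>s. bdiff m (E s) p) (bdiff m F p)"
        by (rule has_bochner_integral_bdiff[of 3]) (use E that in auto)
      have "0 \<le> bdiff m (E s) p" for s
        using that assms(1) by (intro bdiff_exp_powr_cone_nonneg[OF _ cone]) auto
      then have "0 \<le> (\<integral>s. bdiff m (E s) p \<partial>lborel)" by (intro Bochner_Integration.integral_nonneg) simp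
      then show ?thesis using has_bochner_integral_integral_eq[OF int] by simp
    qed
    show "wave_kernel r t = 0" if "t < 0" for t
      using that by (simp add: wave_kernel_def set_lebesgue_integral_def)
  qed (use assms in \<open>auto intro: continuous_on_wave_kernel\<close>)
qed

text \<open>Local integrability on the half-line closed at 0 is expressed by integrability over each
  of its compact subsets, so that the behaviour as t tends to 0 is included.\<close>

theorem lemma3p2:
  shows "(\<forall>r>0.
            (\<forall>t>0. set_integrable lborel {0<..} (G1_integrand t r)) \<and>
            continuous_on {0<..} (\<lambda>t. G1 t r) \<and>
            (\<forall>K. compact K \<and> K \<subseteq> {0..} \<longrightarrow> set_integrable lborel K (\<lambda>t. G1 t r))) \<and>
         (\<forall>T>0. \<exists>C>0. \<forall>t r. 0 < t \<and> t \<le> T \<and> 0 < r \<and> r \<le> 1 \<longrightarrow>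
            \<bar>G1 t r\<bar> \<le> C * (1 + \<bar>ln r\<bar>)) \<and>
         (\<forall>t>0. \<forall>r>0. G1 t r \<ge> 0)"
proof (intro conjI allI impI)
  show "0 \<le> G1 t r" if "0 < t" "0 < r" for t r
    using that by (simp add: G1_eq_wave_kernel(2) wave_kernel_nonneg)
  show "set_integrable lborel {0<..} (G1_integrand t r)" if "0 < r" "0 < t" for t r
    using that by (intro G1_eq_wave_kernel(1))
  show "continuous_on {0<..} (\<lambda>t. G1 t r)" if "0 < r" for r
    using that by (rule continuous_on_G1)
  show "set_integrable lborel K (\<lambda>t. G1 t r)" if "0 < r" "compact K \<and> K \<subseteq> {0..}" for r K
    using that by (intro set_integrable_G1) auto
  show "\<exists>C>0. \<forall>t r. 0 < t \<and> t \<le> T \<and> 0 < r \<and> r \<le> 1 \<longrightarrow> \<bar>G1 t r\<bar> \<le> C * (1 + \<bar>ln r\<bar>)" if "0 < T" for T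
    using that by (rule G1_log_bound)
qed

end
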